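(* Let $N\ge2$, $\alpha\in\mathbb{R}$, let $\Omega$ be an open convex set in $\mathbb{R}^2$ and let $u\in\mathscr{D}^N_{0,\alpha}$ be an $N$-anyon wave function. Then $$\int_{\Omega^N}\sum_{j=1}^N|D_ju|^2\,dx\ \ge\ \frac{4C_{\alpha,N}^2}{N}\int_{\Omega^N}\sum_{1\le i<j\le N}\frac{|u|^2}{|\mathbf{x}_i-\mathbf{x}_j|^2}\,\chi_{\Omega\circ\Omega}(\mathbf{x}_i,\mathbf{x}_j)\,dx,$$ where $$\Omega\circ\Omega:=\left\{(\mathbf{y}_1,\mathbf{y}_2)\in\Omega^2:\tfrac12|\mathbf{y}_1-\mathbf{y}_2|<\operatorname{dist}\left(\tfrac12(\mathbf{y}_1+\mathbf{y}_2),\Omega^c\right)\right\}$$ and $$C_{\alpha,N}:=\min_{p=0,1,\ldots,N-2}\ \min_{q\in\mathbb{Z}}|(2p+1)\alpha-2q|.$$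
   Context: Points of $\mathbb{R}^{2N}=(\mathbb{R}^2)^N$ are written $x=(\mathbf{x}_1,\ldots,\mathbf{x}_N)$, and $\mathbb{D}:=\{x\in\mathbb{R}^{2N}:\mathbf{x}_j=\mathbf{x}_k\text{ for some }j\ne k\}$. For $0\neq\mathbf{a}\in\mathbb{R}^2$ write $\mathbf{a}^{-1}:=\mathbf{a}/|\mathbf{a}|^2$, and let $\mathbf{a}\mapsto\mathbf{a}I$ denote counter-clockwise rotation by $\pi/2$. For a real statistics parameter $\alpha$ the covariant derivatives are $$D_j:=-i\nabla_{\mathbf{x}_j}+\alpha\sum_{k\ne j}(\mathbf{x}_j-\mathbf{x}_k)^{-1}I,\qquad j=1,\ldots,N.$$ Consider the quadratic form $q(u)=\sum_{j=1}^N\int_{\mathbb{R}^{2N}}|D_ju|^2\,dx$ on the complex-valued functions in $C_0^\infty(\mathbb{R}^{2N}\setminus\mathbb{D})$ that are totally symmetric under permutations of the $N$ particles. $\mathscr{D}^N_{0,\alpha}$ is the domain of the closure of $q$ in the Hilbert space of totally symmetric functions in $L^2(\mathbb{R}^{2N})$. For $u\in\mathscr{D}^N_{0,\alpha}$, $D_ju\in L^2$ denotes the corresponding $L^2$-limit (equivalently, the distributional expression on $\mathbb{R}^{2N}\setminus\mathbb{D}$). $\chi_A$ is the characteristic function of a set $A$, $\Omega^c=\mathbb{R}^2\setminus\Omega$, and $\operatorname{dist}(\cdot,\emptyset)=+\infty$. If $C_{\alpha,N}=0$ the right-hand side of the inequality is read as $0$. *)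

theory Defs
  imports "HOL-Analysis.Analysis"
begin

text \<open>
  The particles are labelled by a finite linearly ordered type \<open>'n\<close>, so \<open>N = CARD('n)\<close> and a
  configuration is an element of \<open>real^2^'n\<close>, with \<open>x $ j\<close> the position of particle \<open>j\<close>.
\<close>

type_synonym 'n config = "real^2^'n"

text \<open>The diagonal set.\<close>
definition coincidence :: "('n::finite) config set" where
  "coincidence = {x. \<exists>j k. j \<noteq> k \<and> x $ j = x $ k}"

definition vinv :: "real^2 \<Rightarrow> real^2" where
  "vinv a = a /\<^sub>R (norm a)\<^sup>2"

text \<open>Counter-clockwise rotation by \<open>\<pi>/2\<close>.\<close>
definition rot :: "real^2 \<Rightarrow> real^2" where
  "rot a = vector [- (a $ 2), a $ 1]"


subsection \<open>Test functions\<close>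

primrec Ck :: "nat \<Rightarrow> ('a::euclidean_space \<Rightarrow> 'b::real_normed_vector) \<Rightarrow> bool" where
  "Ck 0 f \<longleftrightarrow> continuous_on UNIV f"
| "Ck (Suc k) f \<longleftrightarrow>
     f differentiable_on UNIV \<and> (\<forall>v. Ck k (\<lambda>x. frechet_derivative f (at x) v))"

definition smooth :: "('a::euclidean_space \<Rightarrow> 'b::real_normed_vector) \<Rightarrow> bool" where
  "smooth f \<longleftrightarrow> (\<forall>k. Ck k f)"

text \<open>
  Totally symmetric elements of \<open>C\<^sub>0\<^sup>\<infinity>\<close> of the complement of the diagonal set, extended by zero to
  the whole space.
\<close>
definition sym_test_functions :: "('n::finite config \<Rightarrow> complex) set" where
  "sym_test_functions = {\<phi>. smooth \<phi>
     \<and> compact (closure {x. \<phi> x \<noteq> 0}) \<and> closure {x. \<phi> x \<noteq> 0} \<inter> coincidence = {}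
     \<and> (\<forall>\<sigma>. bij \<sigma> \<longrightarrow> (\<forall>x. \<phi> (\<chi> j. x $ \<sigma> j) = \<phi> x))}"


subsection \<open>Square-integrable functions\<close>

text \<open>Elements of \<open>L\<^sup>2\<close> are handled through Lebesgue measurable representatives.\<close>

definition L2_normsq :: "('a::euclidean_space \<Rightarrow> 'b::euclidean_space) \<Rightarrow> ennreal" where
  "L2_normsq f = (\<integral>\<^sup>+x. ennreal ((norm (f x))\<^sup>2) \<partial>lebesgue)"

definition L2 :: "('a::euclidean_space \<Rightarrow> 'b::euclidean_space) set" where
  "L2 = {f \<in> borel_measurable lebesgue. L2_normsq f < \<infinity>}"

definition L2_tendsto ::
    "(nat \<Rightarrow> 'a::euclidean_space \<Rightarrow> 'b::euclidean_space) \<Rightarrow> ('a \<Rightarrow> 'b) \<Rightarrow> bool" where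
  "L2_tendsto F f \<longleftrightarrow> (\<lambda>n. L2_normsq (\<lambda>x. F n x - f x)) \<longlonglongrightarrow> 0"

definition L2_sym :: "('n::finite config \<Rightarrow> complex) set" where
  "L2_sym = {u \<in> L2. \<forall>\<sigma>. bij \<sigma> \<longrightarrow> (AE x in lebesgue. u (\<chi> j. x $ \<sigma> j) = u x)}"


subsection \<open>Covariant derivatives and the quadratic form\<close>

text \<open>The classical expression for \<open>D\<^sub>j \<phi>\<close>; component \<open>i\<close> of its value is with respect to the
  \<open>i\<close>-th coordinate of particle \<open>j\<close>.\<close>
definition cov_deriv_test ::
    "real \<Rightarrow> 'n::finite \<Rightarrow> ('n config \<Rightarrow> complex) \<Rightarrow> 'n config \<Rightarrow> complex^2" where
  "cov_deriv_test \<alpha> j \<phi> x = (\<chi> i.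
     - \<i> * frechet_derivative \<phi> (at x) (axis j (axis i 1))
     + of_real (\<alpha> * (\<Sum>k\<in>-{j}. rot (vinv (x $ j - x $ k)) $ i)) * \<phi> x)"

definition qform :: "real \<Rightarrow> ('n::finite config \<Rightarrow> complex) \<Rightarrow> ennreal" where
  "qform \<alpha> \<phi> = (\<Sum>j\<in>UNIV. L2_normsq (cov_deriv_test \<alpha> j \<phi>))"

text \<open>Approximating sequences of the form closure: converging in \<open>L\<^sup>2\<close> and Cauchy for \<open>qform\<close>.\<close>
definition form_approx ::
    "real \<Rightarrow> (nat \<Rightarrow> 'n::finite config \<Rightarrow> complex) \<Rightarrow> ('n config \<Rightarrow> complex) \<Rightarrow> bool" where
  "form_approx \<alpha> \<phi> u \<longleftrightarrow> (\<forall>n. \<phi> n \<in> sym_test_functions) \<and> L2_tendsto \<phi> u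
     \<and> (\<forall>e>0. \<exists>M. \<forall>m\<ge>M. \<forall>n\<ge>M. qform \<alpha> (\<lambda>x. \<phi> m x - \<phi> n x) < e)"

definition anyon_domain :: "real \<Rightarrow> ('n::finite config \<Rightarrow> complex) set" where
  "anyon_domain \<alpha> = {u \<in> L2_sym. \<exists>\<phi>. form_approx \<alpha> \<phi> u}"

text \<open>
  For \<open>u\<close> in the form domain, \<open>cov_deriv \<alpha> u\<close> is a representative of the tuple of \<open>L\<^sup>2\<close>-limits
  \<open>(D\<^sub>j u)\<^sub>j\<close>. The limits exist because \<open>L\<^sup>2\<close> is complete, and up to null sets they do not depend on
  the approximating sequence because the form is closable.
\<close>
definition cov_deriv ::
    "real \<Rightarrow> ('n::finite config \<Rightarrow> complex) \<Rightarrow> 'n \<Rightarrow> 'n config \<Rightarrow> complex^2" where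
  "cov_deriv \<alpha> u = (SOME G. \<exists>\<phi>. form_approx \<alpha> \<phi> u
     \<and> (\<forall>j. G j \<in> L2 \<and> L2_tendsto (\<lambda>n. cov_deriv_test \<alpha> j (\<phi> n)) (G j)))"


subsection \<open>The set \<open>\<Omega> \<circ> \<Omega>\<close> and the constant\<close>

text \<open>Extended-real distance, so that the distance to the empty set is \<open>\<infinity>\<close>; the library's
  \<open>infdist\<close> is \<open>0\<close> there.\<close>
definition edist_set :: "'a::metric_space \<Rightarrow> 'a set \<Rightarrow> ereal" where
  "edist_set y A = (INF z\<in>A. ereal (dist y z))"

definition circ_self :: "(real^2) set \<Rightarrow> ((real^2) \<times> (real^2)) set" where
  "circ_self \<Omega> = {(y1, y2). y1 \<in> \<Omega> \<and> y2 \<in> \<Omega>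
     \<and> ereal (norm (y1 - y2) / 2) < edist_set ((1/2) *\<^sub>R (y1 + y2)) (- \<Omega>)}"

text \<open>The infimum over \<open>q\<close> is a minimum, since the values form a discrete subset of \<open>[0,\<infinity>)\<close>.\<close>
definition anyon_const :: "real \<Rightarrow> nat \<Rightarrow> real" where
  "anyon_const \<alpha> N =
     (MIN p\<in>{0..N-2}. INF q::int. \<bar>real (2 * p + 1) * \<alpha> - 2 * real_of_int q\<bar>)"

definition config_in :: "(real^2) set \<Rightarrow> 'n::finite config set" where
  "config_in \<Omega> = {x. \<forall>j. x $ j \<in> \<Omega>}"

end

theory Submission
  imports Defs
begin

text \<open>
  Since \<open>N \<Sum>\<^sub>j |D\<^sub>j u|\<^sup>2 \<ge> \<Sum>\<^sub>i\<^sub><\<^sub>j |D\<^sub>i u - D\<^sub>j u|\<^sup>2\<close>, each pair can be treated separately.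
  Rotating the relative coordinate of the pair \<open>(i, j)\<close> is an orthogonal transformation of
  configuration space which preserves the region where \<open>(x\<^sub>i, x\<^sub>j) \<in> \<Omega> \<circ> \<Omega>\<close>; averaging over these
  rotations takes the place of polar coordinates and reduces the claim to a one-dimensional
  inequality on almost every orbit. There the exchange symmetry makes \<open>u\<close> periodic after half a turn,
  and gauging away the potential turns the angular derivative into \<open>v'\<close> with the twisted boundary
  condition \<open>v(\<pi>) = exp(i \<pi> (2p+1) \<alpha>) v(0)\<close>, \<open>p\<close> being the number of particles enclosed by the orbit.
  The lowest eigenvalue of \<open>-d\<^sup>2/dt\<^sup>2\<close> under it is \<open>min\<^sub>q |(2p+1)\<alpha> - 2q|\<^sup>2\<close>.
\<close>

subsection \<open>Orthogonal invariance of Lebesgue measure\<close>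

text \<open>The 4 in the constant is geometric: along an orbit the two particles move oppositely,
  each with half the velocity of the relative coordinate, so the component of
  \<open>D_i - D_j\<close> along the circle is twice the angular derivative divided by the distance.
  The odd numbers \<open>2p + 1\<close> arise because over half a turn the pair sees itself once,
  while the two particles together complete a full turn around every enclosed particle and no net
  turn around the others. Two obstacles shape the rest. An orbit that meets a third particle has a
  singular potential and no well-defined flux; such orbits form a null set. And the weight on the
  right-hand side is unbounded, so \<open>L2\<close> convergence of the approximating test functions
  does not carry it to the limit. It is truncated first; the truncated inequality passes to the
  limit at the price of a factor \<open>(1 + e)^2\<close>, then \<open>e\<close> tends to 0, and the
  truncation is removed last by monotone convergence.\<close>

lemma nn_integral_lborel_shift:
  fixes f :: "'a::euclidean_space \<Rightarrow> ennreal"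
  assumes [measurable]: "f \<in> borel_measurable borel"
  shows "(\<integral>\<^sup>+x. f (c + x) \<partial>lborel) = (\<integral>\<^sup>+x. f x \<partial>lborel)"
  by (subst (2) lborel_distr_plus[of c, symmetric]) (simp add: nn_integral_distr)

text \<open>The image measure inherits translation invariance because \<open>T\<close> is linear and
  onto. A translation-invariant measure is a multiple of Lebesgue measure, and balls about the
  origin, which \<open>T\<close> preserves, force the multiple to be 1.\<close>

lemma lborel_distr_orthogonal_transformation:
  fixes T :: "'a::euclidean_space \<Rightarrow> 'a"
  assumes T: "orthogonal_transformation T"
  shows "distr lborel borel T = lborel"
proof -
  define M where "M = distr lborel borel T"
  have lin: "linear T" and surj: "surj T"
    using T by (auto simp: orthogonal_transformation_linear orthogonal_transformation_surj)
  have [measurable]: "T \<in> borel_measurable borel"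
    using lin by (intro borel_measurable_continuous_onI linear_continuous_on) (simp add: linear_conv_bounded_linear)
  have setsM [measurable_cong]: "sets M = sets borel" and spaceM: "space M = UNIV"
    by (auto simp: M_def)
  have shift: "(\<integral>\<^sup>+x. f (c + x) \<partial>M) = (\<integral>\<^sup>+x. f x \<partial>M)"
    if [measurable]: "f \<in> borel_measurable borel" for f :: "'a \<Rightarrow> ennreal" and c
  proof -
    obtain b where c: "c = T b" using surj by auto
    have "(\<integral>\<^sup>+x. f (c + x) \<partial>M) = (\<integral>\<^sup>+x. f (T (b + x)) \<partial>lborel)"
      by (simp add: M_def nn_integral_distr c linear_add[OF lin])
    also have "\<dots> = (\<integral>\<^sup>+x. f (T x) \<partial>lborel)"
      by (rule nn_integral_lborel_shift) measurable
    finally show ?thesis by (simp add: M_def nn_integral_distr)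
  qed
  have ballM: "emeasure M (ball 0 e) = emeasure lborel (ball (0::'a) e)" for e
  proof -
    have "T -` ball 0 e = ball (0::'a) e"
      using orthogonal_transformation_norm[OF T] by auto
    then show ?thesis by (simp add: M_def emeasure_distr)
  qed
  interpret M: sigma_finite_measure M
  proof
    show "\<exists>A. countable A \<and> A \<subseteq> sets M \<and> \<Union>A = space M \<and> (\<forall>a\<in>A. emeasure M a \<noteq> \<infinity>)"
    proof (intro exI[of _ "range (\<lambda>n::nat. ball 0 (real n))"] conjI ballI)
      show "\<Union>(range (\<lambda>n::nat. ball 0 (real n))) = space M"
        using reals_Archimedean2 by (auto simp: spaceM)
      fix a assume "a \<in> range (\<lambda>n::nat. ball (0::'a) (real n))"
      then show "emeasure M a \<noteq> \<infinity>"
        using emeasure_lborel_ball_finite by (auto simp: ballM less_top)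
    qed (auto simp: setsM)
  qed
  interpret P: pair_sigma_finite M "lborel :: 'a measure" ..
  \<comment> \<open>Uniqueness of Haar measure: \<open>M\<close> is translation invariant, and the successive shifts
    of \<open>y\<close> by \<open>x\<close>, of \<open>x\<close> by \<open>- y\<close> and of \<open>y\<close> by \<open>x\<close> interchange the two measures.\<close>
  have key: "emeasure M A * emeasure lborel B = emeasure lborel (uminus -` A) * emeasure M B"
    if [measurable]: "A \<in> sets borel" "B \<in> sets borel" for A B :: "'a set"
  proof -
    let ?a = "indicator A :: 'a \<Rightarrow> ennreal" and ?b = "indicator B :: 'a \<Rightarrow> ennreal"
    have "emeasure M A * emeasure lborel B = (\<integral>\<^sup>+x. ?a x * (\<integral>\<^sup>+y. ?b y \<partial>lborel) \<partial>M)"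
      by (simp add: nn_integral_multc setsM)
    also have "\<dots> = (\<integral>\<^sup>+x. ?a x * (\<integral>\<^sup>+y. ?b (x + y) \<partial>lborel) \<partial>M)"
      by (subst nn_integral_lborel_shift) auto
    also have "\<dots> = (\<integral>\<^sup>+x. (\<integral>\<^sup>+y. ?a x * ?b (x + y) \<partial>lborel) \<partial>M)"
      by (intro nn_integral_cong nn_integral_cmult[symmetric]) measurable
    also have "\<dots> = (\<integral>\<^sup>+y. (\<integral>\<^sup>+x. ?a x * ?b (x + y) \<partial>M) \<partial>lborel)"
      by (rule P.Fubini'[symmetric]) measurable
    also have "\<dots> = (\<integral>\<^sup>+y. (\<integral>\<^sup>+x. ?a (x - y) * ?b x \<partial>M) \<partial>lborel)"
    proof (rule nn_integral_cong)
      fix y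
      show "(\<integral>\<^sup>+x. ?a x * ?b (x + y) \<partial>M) = (\<integral>\<^sup>+x. ?a (x - y) * ?b x \<partial>M)"
        using shift[of "\<lambda>x. ?a (x - y) * ?b x" y] by (simp add: add.commute)
    qed
    also have "\<dots> = (\<integral>\<^sup>+x. (\<integral>\<^sup>+y. ?a (x - y) * ?b x \<partial>lborel) \<partial>M)"
      by (rule P.Fubini') measurable
    also have "\<dots> = (\<integral>\<^sup>+x. (\<integral>\<^sup>+y. ?a (- y) * ?b x \<partial>lborel) \<partial>M)"
    proof (rule nn_integral_cong)
      fix x
      show "(\<integral>\<^sup>+y. ?a (x - y) * ?b x \<partial>lborel) = (\<integral>\<^sup>+y. ?a (- y) * ?b x \<partial>lborel)"
        using nn_integral_lborel_shift[of "\<lambda>y. ?a (x - y) * ?b x" x] by simp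
    qed
    also have "\<dots> = (\<integral>\<^sup>+x. (\<integral>\<^sup>+y. ?a (- y) \<partial>lborel) * ?b x \<partial>M)"
      by (intro nn_integral_cong nn_integral_multc) measurable
    also have "\<dots> = (\<integral>\<^sup>+y. indicator (uminus -` A) y \<partial>lborel) * emeasure M B"
    proof -
      have "?a (- y) = indicator (uminus -` A) y" for y by (simp add: indicator_def)
      then show ?thesis by (simp add: nn_integral_cmult setsM)
    qed
    also have "(\<integral>\<^sup>+y. indicator (uminus -` A) y \<partial>lborel) = emeasure lborel (uminus -` A)"
      using measurable_sets[of uminus "borel :: 'a measure" borel A] that(1) by (intro nn_integral_indicator) simp
    finally show ?thesis .
  qed
  show ?thesis
    unfolding M_def[symmetric]
  proof (rule measure_eqI)
    show "sets M = sets lborel" by (simp add: setsM)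
    fix B assume "B \<in> sets M"
    then have B: "B \<in> sets borel" by (simp add: setsM)
    \<comment> \<open>The unit ball is fixed by negation and has the same measure under
      \<open>M\<close> and \<open>lborel\<close>, positive and finite, so it can be cancelled from
      \<open>key\<close>.\<close>
    have "uminus -` ball 0 1 = ball (0::'a) 1" by auto
    then have "emeasure lborel (ball (0::'a) 1) * emeasure lborel B
        = emeasure lborel (ball (0::'a) 1) * emeasure M B"
      using key[of "ball 0 1" B] B by (simp add: ballM)
    moreover have "emeasure lborel (ball (0::'a) 1) \<noteq> 0" "emeasure lborel (ball (0::'a) 1) \<noteq> \<infinity>"
      using emeasure_lborel_ball_finite[of "0::'a" 1] by (auto simp: emeasure_ball unit_ball_vol_pos less_imp_neq[THEN not_sym] ennreal_eq_0_iff not_le)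
    ultimately show "emeasure M B = emeasure lborel B"
      by (simp add: ennreal_mult_cancel_left)
  qed
qed

subsection \<open>Wirtinger inequalities with a flux\<close>

lemma has_vector_derivative_cis:
  assumes "(\<Phi> has_real_derivative a) (at t)"
  shows "((\<lambda>t. cis (\<Phi> t)) has_vector_derivative \<i> * a * cis (\<Phi> t)) (at t)"
proof -
  have "((\<lambda>t. \<i> * of_real (\<Phi> t)) has_vector_derivative \<i> * of_real a) (at t)"
    using assms by (intro has_vector_derivative_mult_right has_vector_derivative_of_real)
      (simp add: has_real_derivative_iff_has_vector_derivative)
  from field_vector_diff_chain_at[OF this DERIV_exp] show ?thesis
    by (simp add: o_def cis_conv_exp)
qed

text \<open>The auxiliary \<open>w\<close> is the logarithmic derivative of
  \<open>cos (b * (t - pi/2))\<close>, a solution of \<open>y'' = - b^2 * y\<close>. Centring it at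
  the midpoint keeps it positive on the whole interval. For \<open>b = 1\<close> it vanishes at both
  ends, hence the strict bound here and a separate limit argument.\<close>

lemma dirichlet_poincare:
  fixes g g' :: "real \<Rightarrow> complex"
  assumes der: "\<And>t. (g has_vector_derivative g' t) (at t)"
    and cont: "continuous_on UNIV g'"
    and bdry: "g 0 = 0" "g pi = 0" and b: "\<bar>b\<bar> < 1"
  shows "b\<^sup>2 * integral {0..pi} (\<lambda>t. (norm (g t))\<^sup>2) \<le> integral {0..pi} (\<lambda>t. (norm (g' t))\<^sup>2)"
proof -
  \<comment> \<open>\<open>w\<close> solves the Riccati equation \<open>w' + w\<^sup>2 = - b\<^sup>2\<close>, so the claim is \<open>\<bar>g' - w g\<bar>\<^sup>2 \<ge> 0\<close>
    integrated; it is regular on \<open>[0, \<pi>]\<close> because \<open>\<bar>b\<bar> < 1\<close>.\<close>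
  define w where "w t = - b * tan (b * (t - pi/2))" for t
  have contg: "continuous_on S g" for S
    using der by (meson continuous_at_imp_continuous_on has_vector_derivative_continuous)
  have cosne: "cos (b * (t - pi/2)) \<noteq> 0" if "t \<in> {0..pi}" for t
  proof -
    have "\<bar>b * (t - pi/2)\<bar> < pi/2"
    proof (cases "t - pi/2 = 0")
      case False
      then have "\<bar>b\<bar> * \<bar>t - pi/2\<bar> < 1 * \<bar>t - pi/2\<bar>"
        using b by (intro mult_strict_right_mono) auto
      also have "\<dots> \<le> pi/2" using that by (auto simp: abs_le_iff field_simps)
      finally show ?thesis by (simp only: abs_mult)
    qed (simp only: mult_zero_right abs_zero, simp)
    then have "cos (b * (t - pi/2)) > 0" by (intro cos_gt_zero_pi) auto
    then show ?thesis by simp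
  qed
  have dw: "(w has_real_derivative - b\<^sup>2 - (w t)\<^sup>2) (at t)" if "t \<in> {0..pi}" for t
  proof -
    have "(w has_real_derivative - b * (inverse ((cos (b * (t - pi/2)))\<^sup>2) * b)) (at t)"
      unfolding w_def using cosne[OF that] by (auto intro!: derivative_eq_intros)
    moreover have "inverse ((cos (b * (t - pi/2)))\<^sup>2) = 1 + (tan (b * (t - pi/2)))\<^sup>2"
      using tan_sec[OF cosne[OF that]] by (simp add: power_inverse)
    ultimately show ?thesis
      by (simp add: w_def algebra_simps power2_eq_square)
  qed
  have dn: "((\<lambda>t. (norm (g t))\<^sup>2) has_real_derivative 2 * (g t \<bullet> g' t)) (at t)" for t
    unfolding power2_norm_eq_inner has_real_derivative_iff_has_vector_derivative
    using bounded_bilinear.has_vector_derivative[OF bounded_bilinear_inner der der, of t] by (simp add: inner_commute)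
  have dP: "((\<lambda>t. w t * (norm (g t))\<^sup>2) has_vector_derivative
      (- b\<^sup>2 - (w t)\<^sup>2) * (norm (g t))\<^sup>2 + w t * (2 * (g t \<bullet> g' t))) (at t within {0..pi})"
    if "t \<in> {0..pi}" for t
    using DERIV_mult[OF dw[OF that] dn]
    by (auto simp: has_real_derivative_iff_has_vector_derivative mult.commute intro: has_vector_derivative_at_within)
  have I: "((\<lambda>t. (- b\<^sup>2 - (w t)\<^sup>2) * (norm (g t))\<^sup>2 + w t * (2 * (g t \<bullet> g' t))) has_integral 0) {0..pi}"
    using fundamental_theorem_of_calculus[OF _ dP] bdry by simp
  have i1: "(\<lambda>t. b\<^sup>2 * (norm (g t))\<^sup>2) integrable_on {0..pi}" and i2: "(\<lambda>t. (norm (g' t))\<^sup>2) integrable_on {0..pi}"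
    by (auto intro!: integrable_continuous_interval continuous_intros contg continuous_on_subset[OF cont])
  have "integral {0..pi} (\<lambda>t. b\<^sup>2 * (norm (g t))\<^sup>2) + 0 \<le> integral {0..pi} (\<lambda>t. (norm (g' t))\<^sup>2)"
  proof (rule has_integral_le[OF has_integral_add[OF integrable_integral[OF i1] I] integrable_integral[OF i2]])
    fix t assume "t \<in> {0..pi}"
    have "0 \<le> (norm (g' t - w t *\<^sub>R g t))\<^sup>2" by simp
    then show "b\<^sup>2 * (norm (g t))\<^sup>2 + ((- b\<^sup>2 - (w t)\<^sup>2) * (norm (g t))\<^sup>2 + w t * (2 * (g t \<bullet> g' t))) \<le> (norm (g' t))\<^sup>2"
      unfolding power2_norm_eq_inner by (simp add: inner_diff_left inner_diff_right inner_commute algebra_simps power2_eq_square)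
  qed
  then show ?thesis by simp
qed

text \<open>Only the extreme constant 1 needs the limit, taken along \<open>1 - 1/(n+1)\<close>;
  every other admissible \<open>b\<close> follows from \<open>b^2 \<le> 1\<close>.\<close>

lemma dirichlet_poincare_sharp:
  fixes g g' :: "real \<Rightarrow> complex"
  assumes der: "\<And>t. (g has_vector_derivative g' t) (at t)"
    and cont: "continuous_on UNIV g'"
    and bdry: "g 0 = 0" "g pi = 0" and b: "\<bar>b\<bar> \<le> 1"
  shows "b\<^sup>2 * integral {0..pi} (\<lambda>t. (norm (g t))\<^sup>2) \<le> integral {0..pi} (\<lambda>t. (norm (g' t))\<^sup>2)"
proof -
  let ?I = "integral {0..pi} (\<lambda>t. (norm (g t))\<^sup>2)" and ?J = "integral {0..pi} (\<lambda>t. (norm (g' t))\<^sup>2)"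
  have "((\<lambda>n. (1 - inverse (real (Suc n)))\<^sup>2 * ?I) \<longlongrightarrow> (1 - 0)\<^sup>2 * ?I) sequentially"
    by (intro tendsto_intros LIMSEQ_inverse_real_of_nat)
  moreover have "(1 - inverse (real (Suc n)))\<^sup>2 * ?I \<le> ?J" for n
    by (rule dirichlet_poincare[OF der cont bdry]) (auto simp: field_simps)
  ultimately have "(1 - 0)\<^sup>2 * ?I \<le> ?J"
    by (meson LIMSEQ_le_const2)
  moreover have "b\<^sup>2 * ?I \<le> 1 * ?I"
    using b by (intro mult_right_mono integral_nonneg integrable_continuous_interval continuous_intros continuous_at_imp_continuous_on)
      (auto simp: abs_square_le_1 intro!: has_vector_derivative_continuous[OF der])
  ultimately show ?thesis by simp
qed

lemma twisted_wirtinger: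
  fixes v v' :: "real \<Rightarrow> complex"
  assumes der: "\<And>t. (v has_vector_derivative v' t) (at t)"
    and cont: "continuous_on UNIV v'"
    and bdry: "v pi = cis (b * pi) * v 0" and b: "\<bar>b\<bar> \<le> 1"
  shows "b\<^sup>2 * integral {0..pi} (\<lambda>t. (norm (v t))\<^sup>2) \<le> integral {0..pi} (\<lambda>t. (norm (v' t))\<^sup>2)"
proof -
  \<comment> \<open>\<open>h\<close> is the extremal with the boundary values of \<open>v\<close>; the cross terms between \<open>h\<close> and
    \<open>g = v - h\<close> form an exact derivative vanishing at the endpoints.\<close>
  define h where "h t = cis (b * t) * v 0" for t
  define g where "g t = v t - h t" for t
  define g' where "g' t = v' t - \<i> * b * h t" for t
  have dh: "(h has_vector_derivative \<i> * b * h t) (at t)" for t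
    unfolding h_def
    by (auto intro!: derivative_eq_intros has_vector_derivative_cis simp: algebra_simps)
  have dg: "(g has_vector_derivative g' t) (at t)" for t
    unfolding g_def g'_def by (intro derivative_intros der dh)
  have conth: "continuous_on S h" and contv: "continuous_on S v" for S
    using dh der by (meson continuous_at_imp_continuous_on has_vector_derivative_continuous)+
  have cont': "continuous_on S v'" for S
    using cont continuous_on_subset by blast
  have contg': "continuous_on S g'" for S
    unfolding g'_def by (intro continuous_intros conth cont')
  have contg: "continuous_on S g" for S
    unfolding g_def by (intro continuous_intros conth contv)
  have g0: "g 0 = 0" "g pi = 0"
    using bdry by (auto simp: g_def h_def)
  let ?c = "\<lambda>t. 2 * ((\<i> * b * (\<i> * b * h t)) \<bullet> g t + (\<i> * b * h t) \<bullet> g' t)"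
  have dP: "((\<lambda>t. 2 * ((\<i> * b * h t) \<bullet> g t)) has_vector_derivative ?c t) (at t within {0..pi})" for t
  proof -
    have "((\<lambda>t. \<i> * b * h t) has_vector_derivative \<i> * b * (\<i> * b * h t)) (at t)"
      by (intro has_vector_derivative_mult_right dh)
    from has_vector_derivative_mult_right[OF bounded_bilinear.has_vector_derivative[OF bounded_bilinear_inner this dg], of 2]
    show ?thesis by (auto simp: algebra_simps intro!: has_vector_derivative_at_within)
  qed
  have I: "(?c has_integral 0) {0..pi}"
    using fundamental_theorem_of_calculus[OF _ dP] g0 by simp
  have i: "(\<lambda>t. b\<^sup>2 * (norm (v t))\<^sup>2) integrable_on {0..pi}" "(\<lambda>t. (norm (v' t))\<^sup>2) integrable_on {0..pi}"
       "(\<lambda>t. b\<^sup>2 * (norm (g t))\<^sup>2) integrable_on {0..pi}" "(\<lambda>t. (norm (g' t))\<^sup>2) integrable_on {0..pi}"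
    by (auto intro!: integrable_continuous_interval continuous_intros contg contg' contv cont')
  \<comment> \<open>The terms quadratic in \<open>h\<close> cancel because the derivative of
    \<open>h\<close> has norm \<open>\<bar>b\<bar>\<close> times that of \<open>h\<close>. The mixed
    terms are exactly \<open>?c t\<close> because \<open>h'' = - b^2 * h\<close>. Thus the quadratic
    functional has the same integral for \<open>v\<close> as for \<open>g\<close>, which has
    Dirichlet data.\<close>
  have eq: "(norm (v' t))\<^sup>2 - b\<^sup>2 * (norm (v t))\<^sup>2 = (norm (g' t))\<^sup>2 - b\<^sup>2 * (norm (g t))\<^sup>2 + ?c t" for t
  proof -
    have "v t = g t + h t" "v' t = g' t + \<i> * b * h t"
      by (auto simp: g_def g'_def)
    have n1: "(norm (g' t + \<i> * b * h t))\<^sup>2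
        = (norm (g' t))\<^sup>2 + (norm (\<i> * b * h t))\<^sup>2 + 2 * ((\<i> * b * h t) \<bullet> g' t)"
      by (simp add: power2_norm_eq_inner inner_add_left inner_add_right inner_commute)
    have n2: "(norm (g t + h t))\<^sup>2 = (norm (g t))\<^sup>2 + (norm (h t))\<^sup>2 + 2 * (h t \<bullet> g t)"
      by (simp add: power2_norm_eq_inner inner_add_left inner_add_right inner_commute)
    have n3: "(\<i> * b * (\<i> * b * h t)) \<bullet> g t = - (b\<^sup>2) * (h t \<bullet> g t)"
    proof -
      have "\<i> * b * (\<i> * b * h t) = (- (b\<^sup>2)) *\<^sub>R h t"
        by (simp add: complex_eq_iff power2_eq_square)
      then show ?thesis by (simp only: inner_scaleR_left)
    qed
    have n4: "(norm (\<i> * b * h t))\<^sup>2 = b\<^sup>2 * (norm (h t))\<^sup>2"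
      by (simp add: norm_mult power_mult_distrib)
    show ?thesis
      unfolding \<open>v t = g t + h t\<close> \<open>v' t = g' t + \<i> * b * h t\<close> n1 n2 n3 n4 by (simp add: distrib_left)
  qed
  have J1: "((\<lambda>t. (norm (v' t))\<^sup>2 - b\<^sup>2 * (norm (v t))\<^sup>2) has_integral
      (integral {0..pi} (\<lambda>t. (norm (g' t))\<^sup>2) - integral {0..pi} (\<lambda>t. b\<^sup>2 * (norm (g t))\<^sup>2)) + 0) {0..pi}"
    unfolding eq by (intro has_integral_add has_integral_diff I integrable_integral i)
  have J2: "((\<lambda>t. (norm (v' t))\<^sup>2 - b\<^sup>2 * (norm (v t))\<^sup>2) has_integral
      (integral {0..pi} (\<lambda>t. (norm (v' t))\<^sup>2) - integral {0..pi} (\<lambda>t. b\<^sup>2 * (norm (v t))\<^sup>2))) {0..pi}"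
    by (intro has_integral_diff integrable_integral i)
  have "integral {0..pi} (\<lambda>t. (norm (v' t))\<^sup>2) - integral {0..pi} (\<lambda>t. b\<^sup>2 * (norm (v t))\<^sup>2)
     = integral {0..pi} (\<lambda>t. (norm (g' t))\<^sup>2) - integral {0..pi} (\<lambda>t. b\<^sup>2 * (norm (g t))\<^sup>2)"
    using has_integral_unique[OF J1 J2] by simp
  with dirichlet_poincare_sharp[OF dg contg' g0 b] show ?thesis by simp
qed

text \<open>Multiplication by \<open>cis (\<Phi> t)\<close> preserves norms and turns
  \<open>f' + i a f\<close> into an ordinary derivative, at the price of a twist by
  \<open>cis (pi * b)\<close> at the right endpoint. The twist depends on \<open>b\<close> only
  modulo 2, which is why the constant is a distance to the even integers.\<close>

lemma gauged_wirtinger: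
  fixes f f' :: "real \<Rightarrow> complex" and a \<Phi> :: "real \<Rightarrow> real"
  assumes der: "\<And>t. (f has_vector_derivative f' t) (at t)"
    and cont: "continuous_on UNIV f'"
    and per: "f pi = f 0"
    and derP: "\<And>t. (\<Phi> has_real_derivative a t) (at t)"
    and conta: "continuous_on UNIV a"
    and flux: "\<Phi> pi - \<Phi> 0 = pi * b"
  shows "(INF q::int. \<bar>b - 2 * real_of_int q\<bar>)\<^sup>2 * integral {0..pi} (\<lambda>t. (norm (f t))\<^sup>2)
     \<le> integral {0..pi} (\<lambda>t. (norm (f' t + \<i> * a t * f t))\<^sup>2)"
proof -
  \<comment> \<open>\<open>2 * q\<close> is an even integer nearest to \<open>b\<close>, so the
    remainder \<open>c\<close> lies in the range \<open>\<bar>c\<bar> \<le> 1\<close> where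
    \<open>twisted_wirtinger\<close> applies.\<close>
  define q where "q = round (b / 2)"
  define c where "c = b - 2 * real_of_int q"
  define v where "v t = cis (\<Phi> t) * f t" for t
  define v' where "v' t = cis (\<Phi> t) * (f' t + \<i> * a t * f t)" for t
  have c1: "\<bar>c\<bar> \<le> 1"
    using of_int_round_abs_le[of "b/2"] unfolding c_def q_def by linarith
  have bdd: "bdd_below (range (\<lambda>q::int. \<bar>b - 2 * real_of_int q\<bar>))"
    by (auto intro!: bdd_belowI[of _ 0])
  have "(INF q::int. \<bar>b - 2 * real_of_int q\<bar>) \<le> \<bar>c\<bar>"
    unfolding c_def by (rule cINF_lower[OF bdd]) auto
  moreover have "0 \<le> (INF q::int. \<bar>b - 2 * real_of_int q\<bar>)"
    by (rule cINF_greatest) auto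
  ultimately have c2: "(INF q::int. \<bar>b - 2 * real_of_int q\<bar>)\<^sup>2 \<le> c\<^sup>2"
    by (metis power2_abs power_mono)
  have dv: "(v has_vector_derivative v' t) (at t)" for t
  proof -
    have "((\<lambda>t. cis (\<Phi> t)) has_vector_derivative \<i> * a t * cis (\<Phi> t)) (at t)"
      by (rule has_vector_derivative_cis[OF derP])
    from has_vector_derivative_mult[OF this der] show ?thesis
      unfolding v_def v'_def by (simp add: algebra_simps)
  qed
  have cf: "continuous_on S f" and cP: "continuous_on S \<Phi>" for S
    using der derP by (meson continuous_at_imp_continuous_on has_vector_derivative_continuous DERIV_isCont)+
  have cv': "continuous_on UNIV v'"
    unfolding v'_def by (intro continuous_intros cont conta cf cP)
  have "\<Phi> pi = \<Phi> 0 + (c * pi + 2 * pi * of_int q)"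
    using flux by (simp add: c_def algebra_simps)
  then have "cis (\<Phi> pi) = cis (\<Phi> 0) * (cis (c * pi) * cis (2 * pi * of_int q))"
    by (simp only: cis_mult)
  then have bd: "v pi = cis (c * pi) * v 0"
    by (simp add: v_def per cis_multiple_2pi)
  have n: "norm (v t) = norm (f t)" "norm (v' t) = norm (f' t + \<i> * a t * f t)" for t
    by (simp_all add: v_def v'_def norm_mult)
  have "integral {0..pi} (\<lambda>t. (norm (f t))\<^sup>2) \<ge> 0"
    by (intro integral_nonneg integrable_continuous_interval continuous_intros cf) auto
  with c2 have "(INF q::int. \<bar>b - 2 * real_of_int q\<bar>)\<^sup>2 * integral {0..pi} (\<lambda>t. (norm (f t))\<^sup>2)
     \<le> c\<^sup>2 * integral {0..pi} (\<lambda>t. (norm (f t))\<^sup>2)"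
    by (rule mult_right_mono)
  also have "\<dots> \<le> integral {0..pi} (\<lambda>t. (norm (f' t + \<i> * a t * f t))\<^sup>2)"
    using twisted_wirtinger[OF dv cv' bd c1] by (simp add: n)
  finally show ?thesis .
qed

section \<open>Total change of argument around a third particle\<close>

lemma one_minus_notin_nonpos_Reals: "norm (q::complex) < 1 \<Longrightarrow> 1 - q \<notin> \<real>\<^sub>\<le>\<^sub>0"
  using complex_Re_le_cmod[of q] by (auto simp: complex_nonpos_Reals_iff)

text \<open>
  The primitive is the change of argument of \<open>exp(2it) z\<^sup>2 - w\<^sup>2\<close>, written with logarithms that stay in
  the right half plane.
\<close>
lemma vortex_pair_primitive:
  fixes z w :: complex
  assumes "z \<noteq> 0" and "norm w \<noteq> norm z"
  obtains F where
    "\<And>t. (F has_real_derivative Re (cis t * z / (cis t * z - w)) + Re (cis t * z / (cis t * z + w))) (at t)"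
    "F pi - F 0 = (if norm w < norm z then 2 * pi else 0)"
proof (cases "norm w < norm z")
  case True
  define q where "q t = w / z * cis (- t)" for t
  have q1: "norm (q t) < 1" for t
    using True by (simp add: q_def norm_mult norm_divide divide_simps)
  have dq: "(q has_vector_derivative - \<i> * q t) (at t)" for t
    unfolding q_def
    by (auto intro!: derivative_eq_intros has_vector_derivative_cis simp: algebra_simps)
  \<comment> \<open>With \<open>c = cis t * z\<close> one has
    \<open>c^2 - w^2 = c^2 * (1 - q) * (1 + q)\<close>, and \<open>2 * t\<close> is the argument
    gained by \<open>c^2\<close>. At \<open>t = pi\<close> the sign of \<open>q\<close> has changed,
    so the two logarithms trade places and exactly \<open>2 * pi\<close> remains.\<close>
  define F where "F t = 2 * t + Im (Ln (1 - q t)) + Im (Ln (1 - (- q t)))" for t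
  have L: "((\<lambda>t. Im (Ln (1 - s * q t))) has_real_derivative Re (1 / (1 - s * q t)) - 1) (at t)"
    if "s = 1 \<or> s = -1" for s :: complex and t
  proof -
    have n1: "norm (s * q t) < 1" using that q1 by auto
    then have ne: "1 - s * q t \<noteq> 0" by auto
    have "((\<lambda>t. Ln (1 - s * q t)) has_vector_derivative (- (s * (- \<i> * q t))) * (1 / (1 - s * q t))) (at t)"
    proof -
      have "((\<lambda>t. 1 - s * q t) has_vector_derivative - (s * (- \<i> * q t))) (at t)"
        by (auto intro!: derivative_eq_intros dq)
      from field_vector_diff_chain_at[OF this has_field_derivative_Ln[OF one_minus_notin_nonpos_Reals[OF n1]]]
      show ?thesis by (simp add: o_def inverse_eq_divide)
    qed
    then have "((\<lambda>t. Im (Ln (1 - s * q t))) has_vector_derivative Im ((- (s * (- \<i> * q t))) * (1 / (1 - s * q t)))) (at t)"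
      by (rule bounded_linear.has_vector_derivative[OF bounded_linear_Im])
    moreover have "(- (s * (- \<i> * q t))) * (1 / (1 - s * q t)) = \<i> * (1 / (1 - s * q t) - 1)"
    proof -
      have "1 / (1 - s * q t) - 1 = s * q t / (1 - s * q t)"
        using diff_divide_distrib[of 1 "1 - s * q t" "1 - s * q t"] ne by simp
      then show ?thesis by simp
    qed
    ultimately show ?thesis
      by (simp only: has_real_derivative_iff_has_vector_derivative Im_i_times minus_complex.sel one_complex.sel)
  qed
  have "(F has_real_derivative Re (cis t * z / (cis t * z - w)) + Re (cis t * z / (cis t * z + w))) (at t)" for t
  proof -
    have c0: "cis t * z \<noteq> 0" using assms by simp
    have q: "q t = w / (cis t * z)"
      unfolding q_def cis_inverse[symmetric] divide_inverse inverse_mult_distrib by (simp only: ac_simps)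
    have *: "1 / (1 - q t) = cis t * z / (cis t * z - w)" "1 / (1 + q t) = cis t * z / (cis t * z + w)"
    proof -
      have "1 - q t = (cis t * z - w) / (cis t * z)" "1 + q t = (cis t * z + w) / (cis t * z)"
        unfolding q diff_divide_distrib add_divide_distrib by (simp_all only: divide_self[OF c0])
      then show "1 / (1 - q t) = cis t * z / (cis t * z - w)" "1 / (1 + q t) = cis t * z / (cis t * z + w)"
        by (simp_all only: divide_divide_eq_right mult_1_left)
    qed
    have "(F has_real_derivative 2 + (Re (1 / (1 - q t)) - 1) + (Re (1 / (1 + q t)) - 1)) (at t)"
      unfolding F_def using DERIV_add[OF DERIV_add[OF DERIV_cmult[OF DERIV_ident, of 2] L[of 1 t]] L[of "-1" t]]
      by simp
    then show ?thesis by (simp add: *)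
  qed
  moreover have "F pi - F 0 = 2 * pi"
  proof -
    have "cis (- pi) = - 1" by (simp add: complex_eq_iff)
    then show ?thesis by (simp add: F_def q_def)
  qed
  ultimately show ?thesis using that True by auto
next
  case False
  then have less: "norm z < norm w" using assms by simp
  then have w0: "w \<noteq> 0" by auto
  define q where "q t = z / w * cis t" for t
  have q1: "norm (q t) < 1" for t
    using less w0 by (simp add: q_def norm_mult norm_divide divide_simps)
  have dq: "(q has_vector_derivative \<i> * q t) (at t)" for t
    unfolding q_def
    by (auto intro!: derivative_eq_intros has_vector_derivative_cis simp: algebra_simps)
  \<comment> \<open>Now \<open>c^2 - w^2 = - w^2 * (1 - q) * (1 + q)\<close>, whose prefactor is
    constant: there is no linear term, and the exchange of the two logarithms leaves no net
    change.\<close>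
  define F where "F t = Im (Ln (1 - q t)) + Im (Ln (1 - (- q t)))" for t
  have L: "((\<lambda>t. Im (Ln (1 - s * q t))) has_real_derivative Re (- (s * q t) / (1 - s * q t))) (at t)"
    if "s = 1 \<or> s = -1" for s :: complex and t
  proof -
    have n1: "norm (s * q t) < 1" using that q1 by auto
    have "((\<lambda>t. Ln (1 - s * q t)) has_vector_derivative (- (s * (\<i> * q t))) * (1 / (1 - s * q t))) (at t)"
    proof -
      have "((\<lambda>t. 1 - s * q t) has_vector_derivative - (s * (\<i> * q t))) (at t)"
        by (auto intro!: derivative_eq_intros dq)
      from field_vector_diff_chain_at[OF this has_field_derivative_Ln[OF one_minus_notin_nonpos_Reals[OF n1]]]
      show ?thesis by (simp add: o_def inverse_eq_divide)
    qed
    then have "((\<lambda>t. Im (Ln (1 - s * q t))) has_vector_derivative Im ((- (s * (\<i> * q t))) * (1 / (1 - s * q t)))) (at t)"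
      by (rule bounded_linear.has_vector_derivative[OF bounded_linear_Im])
    moreover have "(- (s * (\<i> * q t))) * (1 / (1 - s * q t)) = \<i> * (- (s * q t) / (1 - s * q t))"
      by simp
    ultimately show ?thesis
      by (simp only: has_real_derivative_iff_has_vector_derivative Im_i_times minus_complex.sel one_complex.sel)
  qed
  have "(F has_real_derivative Re (cis t * z / (cis t * z - w)) + Re (cis t * z / (cis t * z + w))) (at t)" for t
  proof -
    have q: "q t = cis t * z / w"
      by (simp add: q_def)
    have *: "- q t / (1 - q t) = cis t * z / (cis t * z - w)" "q t / (1 + q t) = cis t * z / (cis t * z + w)"
    proof -
      have e: "1 - q t = - ((cis t * z - w) / w)" "1 + q t = (cis t * z + w) / w"
        unfolding q by (simp_all only: minus_divide_left diff_divide_distrib add_divide_distrib minus_diff_eq divide_self[OF w0] add.commute)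
      show "- q t / (1 - q t) = cis t * z / (cis t * z - w)"
        unfolding e(1) minus_divide_divide unfolding q using w0 by simp
      show "q t / (1 + q t) = cis t * z / (cis t * z + w)"
        unfolding e(2) unfolding q using w0 by simp
    qed
    have "(F has_real_derivative Re (- q t / (1 - q t)) + Re (q t / (1 + q t))) (at t)"
      unfolding F_def using DERIV_add[OF L[of 1 t] L[of "-1" t]] by simp
    then show ?thesis by (simp only: *)
  qed
  moreover have "F pi - F 0 = 0"
    by (simp add: F_def q_def cis_pi)
  ultimately show ?thesis using that False by auto
qed

subsection \<open>Rotation of a pair of particles\<close>

text \<open>
  Rotation of the relative coordinate \<open>x $ i - x $ j\<close> by the angle \<open>t\<close>, with the midpoint of the pair
  and all other particles fixed.
\<close>
definition relrot :: "'n::finite \<Rightarrow> 'n \<Rightarrow> real \<Rightarrow> 'n config \<Rightarrow> 'n config" where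
  "relrot i j t x = x + (let v = ((cos t - 1) / 2) *\<^sub>R (x $ i - x $ j) + (sin t / 2) *\<^sub>R rot (x $ i - x $ j)
     in axis i v - axis j v)"

lemma rot_nth [simp]: "rot a $ 1 = - (a $ 2)" "rot a $ 2 = a $ 1"
  by (simp_all add: rot_def vector_2)

lemma linear_rot: "linear rot"
  by (rule linearI) (simp_all add: vec_eq_iff forall_2)

lemma continuous_on_rot: "continuous_on S f \<Longrightarrow> continuous_on S (\<lambda>x. rot (f x))"
  using linear_rot by (intro bounded_linear.continuous_on[of rot]) (simp_all add: linear_conv_bounded_linear)

lemma inner_vec2: "(a::real^2) \<bullet> b = a $ 1 * b $ 1 + a $ 2 * b $ 2"
  by (simp add: inner_vec_def sum_2)

lemma rot_inner [simp]: "a \<bullet> rot a = 0" "rot a \<bullet> a = 0" "rot a \<bullet> rot b = a \<bullet> b"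
  by (simp_all add: inner_vec2)

lemma norm_rot [simp]: "norm (rot a) = norm a"
  by (simp add: norm_eq_sqrt_inner)

lemma inner_rot_combination:
  "(a *\<^sub>R r + b *\<^sub>R rot r) \<bullet> (a *\<^sub>R r + b *\<^sub>R rot r) = (a\<^sup>2 + b\<^sup>2) * (r \<bullet> r)"
  by (simp add: inner_add_left inner_add_right power2_eq_square algebra_simps)

lemma relrot_nth:
  "relrot i j t x $ k = x $ k + ((if k = i then 1 else 0) - (if k = j then 1 else 0)) *\<^sub>R
     (((cos t - 1) / 2) *\<^sub>R (x $ i - x $ j) + (sin t / 2) *\<^sub>R rot (x $ i - x $ j))"
  by (simp add: relrot_def Let_def axis_def)

lemma relrot_other: "k \<noteq> i \<Longrightarrow> k \<noteq> j \<Longrightarrow> relrot i j t x $ k = x $ k"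
  by (simp add: relrot_nth)

lemma relrot_diff:
  assumes "i \<noteq> j"
  shows "relrot i j t x $ i - relrot i j t x $ j = cos t *\<^sub>R (x $ i - x $ j) + sin t *\<^sub>R rot (x $ i - x $ j)"
  using assms by (simp add: relrot_nth vec_eq_iff forall_2 field_simps)

lemma relrot_sum:
  assumes "i \<noteq> j"
  shows "relrot i j t x $ i + relrot i j t x $ j = x $ i + x $ j"
  using assms by (simp add: relrot_nth)

lemma norm_relrot_diff:
  assumes "i \<noteq> j"
  shows "norm (relrot i j t x $ i - relrot i j t x $ j) = norm (x $ i - x $ j)"
proof -
  show ?thesis
    by (simp add: relrot_diff[OF assms] norm_eq_sqrt_inner inner_rot_combination)
qed

text \<open>The pair is displaced by \<open>v\<close> and \<open>- v\<close>, so the new relative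
  coordinate is \<open>r + 2v\<close>. Since it has the length of \<open>r\<close>, the inner
  product of \<open>r\<close> and \<open>v\<close> is minus the square of \<open>v\<close>, which is
  what cancels the change of the norm of \<open>x\<close>.\<close>

lemma orthogonal_relrot:
  assumes "i \<noteq> j"
  shows "orthogonal_transformation (relrot i j t)"
proof -
  have lin: "linear (relrot i j t)"
  proof (rule linearI)
    show "relrot i j t (x + y) = relrot i j t x + relrot i j t y" for x y
      by (subst vec_eq_iff) (simp add: relrot_nth linear_add[OF linear_rot] linear_diff[OF linear_rot] algebra_simps)
    show "relrot i j t (c *\<^sub>R x) = c *\<^sub>R relrot i j t x" for c x
      by (subst vec_eq_iff) (simp add: relrot_nth linear_scale[OF linear_rot] linear_diff[OF linear_rot] algebra_simps)
  qed
  have "norm (relrot i j t x) = norm x" for x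
  proof -
    define r where "r = x $ i - x $ j"
    define v where "v = ((cos t - 1) / 2) *\<^sub>R r + (sin t / 2) *\<^sub>R rot r"
    have eq: "relrot i j t x = x + (axis i v - axis j v)"
      by (simp add: relrot_def v_def r_def Let_def)
    have 1: "x \<bullet> (axis i v - axis j v) = r \<bullet> v"
      by (simp add: inner_diff_right inner_axis r_def inner_diff_left)
    have 2: "(axis i v - axis j v) \<bullet> (axis i v - axis j v) = 2 * (v \<bullet> v)"
      using assms by (simp add: inner_diff_right inner_diff_left inner_axis_axis)
    have 3: "r \<bullet> v = ((cos t - 1) / 2) * (r \<bullet> r)"
      by (simp add: v_def inner_add_right)
    have "v \<bullet> v = ((cos t - 1)\<^sup>2 + (sin t)\<^sup>2) / 4 * (r \<bullet> r)"
      unfolding v_def inner_rot_combination by (simp add: power_divide add_divide_distrib)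
    also have "(cos t - 1)\<^sup>2 + (sin t)\<^sup>2 = 2 - 2 * cos t"
      using sin_cos_squared_add[of t] by (simp add: power2_diff)
    finally have 4: "v \<bullet> v = (1 - cos t) / 2 * (r \<bullet> r)"
      by (simp add: left_diff_distrib)
    have "relrot i j t x \<bullet> relrot i j t x = x \<bullet> x + 2 * (x \<bullet> (axis i v - axis j v))
        + (axis i v - axis j v) \<bullet> (axis i v - axis j v)"
      unfolding eq by (simp add: inner_add_left inner_add_right inner_commute)
    also have "\<dots> = x \<bullet> x"
      unfolding 1 2 3 4 by (simp add: field_simps)
    finally show ?thesis by (simp add: norm_eq_sqrt_inner)
  qed
  with lin show ?thesis by (simp add: orthogonal_transformation)
qed

lemma relrot_0: "relrot i j 0 x = x"
  by (simp add: vec_eq_iff relrot_nth)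

lemma relrot_pi:
  assumes "i \<noteq> j"
  shows "relrot i j pi x = (\<chi> k. x $ (Fun.swap i j id) k)"
  using assms by (auto simp: vec_eq_iff relrot_nth forall_2 Fun.swap_def)

lemma continuous_relrot: "continuous_on UNIV (\<lambda>(t, x). relrot i j t x)"
proof -
  have eq: "relrot i j t x = (\<chi> k. x $ k + ((if k = i then 1 else 0) - (if k = j then 1 else 0)) *\<^sub>R
     (((cos t - 1) / 2) *\<^sub>R (x $ i - x $ j) + (sin t / 2) *\<^sub>R rot (x $ i - x $ j)))" for t x
    by (simp add: vec_eq_iff relrot_nth)
  show ?thesis
    unfolding eq case_prod_unfold
    by (intro continuous_intros continuous_on_vec_lambda continuous_on_rot) auto
qed

text \<open>The velocity is written in terms of the current configuration, not the initial one, so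
  that it is the direction in which \<open>cov_deriv_pair\<close> evaluates the derivative at that
  configuration.\<close>

lemma relrot_has_vector_derivative:
  assumes "i \<noteq> j"
  shows "((\<lambda>t. relrot i j t x) has_vector_derivative
     (1/2) *\<^sub>R (axis i (rot (relrot i j t x $ i - relrot i j t x $ j))
       - axis j (rot (relrot i j t x $ i - relrot i j t x $ j)))) (at t)"
proof -
  define r where "r = x $ i - x $ j"
  have L: "linear (\<lambda>v::real^2. axis i v - axis j v)"
    by (rule linearI) (simp_all add: vec_eq_iff axis_def algebra_simps)
  then have BL: "bounded_linear (\<lambda>v::real^2. axis i v - axis j v)"
    by (simp add: linear_conv_bounded_linear)
  have "((\<lambda>t. ((cos t - 1) / 2) *\<^sub>R r + (sin t / 2) *\<^sub>R rot r) has_vector_derivative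
      ((- sin t) / 2) *\<^sub>R r + (cos t / 2) *\<^sub>R rot r) (at t)"
    by (auto intro!: derivative_eq_intros simp: has_real_derivative_iff_has_vector_derivative[symmetric])
  from bounded_linear.has_vector_derivative[OF BL this]
  have "((\<lambda>t. relrot i j t x) has_vector_derivative
     0 + (axis i (((- sin t) / 2) *\<^sub>R r + (cos t / 2) *\<^sub>R rot r) - axis j (((- sin t) / 2) *\<^sub>R r + (cos t / 2) *\<^sub>R rot r))) (at t)"
    unfolding relrot_def Let_def r_def[symmetric]
    by (intro has_vector_derivative_add has_vector_derivative_const)
  also have "0 + (axis i (((- sin t) / 2) *\<^sub>R r + (cos t / 2) *\<^sub>R rot r) - axis j (((- sin t) / 2) *\<^sub>R r + (cos t / 2) *\<^sub>R rot r))
    = (1/2) *\<^sub>R (axis i (rot (cos t *\<^sub>R r + sin t *\<^sub>R rot r))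
       - axis j (rot (cos t *\<^sub>R r + sin t *\<^sub>R rot r)))"
    by (simp add: vec_eq_iff axis_def forall_2 field_simps)
  finally show ?thesis by (simp add: relrot_diff[OF assms] r_def)
qed

text \<open>Both points lie at distance \<open>norm (y1 - y2) / 2\<close> from their midpoint, so
  the strict inequality places them inside \<open>\<Omega>\<close>. In this form the condition
  involves only the midpoint and the mutual distance, the two quantities that \<open>relrot\<close>
  leaves fixed.\<close>

lemma circ_self_alt:
  "(y1, y2) \<in> circ_self \<Omega> \<longleftrightarrow> ereal (norm (y1 - y2) / 2) < edist_set ((1/2) *\<^sub>R (y1 + y2)) (- \<Omega>)"
proof -
  have "y \<in> \<Omega>" if "ereal (norm (y1 - y2) / 2) < edist_set ((1/2) *\<^sub>R (y1 + y2)) (- \<Omega>)"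
    and "y = y1 \<or> y = y2" for y
  proof (rule ccontr)
    assume "y \<notin> \<Omega>"
    then have "edist_set ((1/2) *\<^sub>R (y1 + y2)) (- \<Omega>) \<le> ereal (dist ((1/2) *\<^sub>R (y1 + y2)) y)"
      unfolding edist_set_def by (intro INF_lower) auto
    also have "dist ((1/2) *\<^sub>R (y1 + y2)) y = norm (y1 - y2) / 2"
    proof -
      have "(1/2) *\<^sub>R (y1 + y2) - y1 = - ((1/2) *\<^sub>R (y1 - y2))" "(1/2) *\<^sub>R (y1 + y2) - y2 = (1/2) *\<^sub>R (y1 - y2)"
        by (simp_all add: vec_eq_iff field_simps)
      then show ?thesis using that(2) by (auto simp: dist_norm)
    qed
    finally show False using that(1) by simp
  qed
  then show ?thesis by (auto simp: circ_self_def)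
qed

definition pair_region :: "(real^2) set \<Rightarrow> 'n::finite \<Rightarrow> 'n \<Rightarrow> 'n config set" where
  "pair_region \<Omega> i j = {x \<in> config_in \<Omega>. (x $ i, x $ j) \<in> circ_self \<Omega>}"

lemma pair_region_alt:
  "x \<in> pair_region \<Omega> i j \<longleftrightarrow> (x $ i, x $ j) \<in> circ_self \<Omega> \<and> (\<forall>k. k \<noteq> i \<longrightarrow> k \<noteq> j \<longrightarrow> x $ k \<in> \<Omega>)"
  by (auto simp: pair_region_def config_in_def circ_self_def)

lemma relrot_pair_region:
  assumes "i \<noteq> j"
  shows "relrot i j t x \<in> pair_region \<Omega> i j \<longleftrightarrow> x \<in> pair_region \<Omega> i j"
  unfolding pair_region_alt circ_self_alt norm_relrot_diff[OF assms] relrot_sum[OF assms]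
  by (auto simp: relrot_other)

lemma edist_set_eq_infdist:
  assumes "A \<noteq> {}"
  shows "edist_set y A = ereal (infdist y A)"
proof -
  have "bdd_below (dist y ` A)" by (auto intro!: bdd_belowI[of _ 0])
  from ereal_Inf'[OF this] assms show ?thesis
    by (simp add: edist_set_def infdist_def image_image)
qed

lemma open_config_in:
  assumes "open \<Omega>"
  shows "open (config_in \<Omega> :: 'n::finite config set)"
proof -
  have "config_in \<Omega> = (\<Inter>k. (\<lambda>x::'n config. x $ k) -` \<Omega>)"
    by (auto simp: config_in_def)
  also have "open \<dots>"
    using assms by (intro open_INT ballI open_vimage continuous_intros) auto
  finally show ?thesis .
qed

lemma open_pair_region:
  assumes "open \<Omega>"
  shows "open (pair_region \<Omega> i j :: 'n::finite config set)"
\<comment> \<open>For the whole plane the distance to the complement is infinite, whereas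
  \<open>infdist\<close> would return 0; the condition on the pair is then always true.\<close>
proof (cases "- \<Omega> = {}")
  case True
  then have "pair_region \<Omega> i j = (config_in \<Omega> :: 'n config set)"
    by (auto simp: pair_region_def circ_self_alt edist_set_def top_ereal_def)
  then show ?thesis using open_config_in[OF assms] by simp
next
  case False
  have "pair_region \<Omega> i j = config_in \<Omega> \<inter>
     {x :: 'n config. norm (x $ i - x $ j) / 2 < infdist ((1/2) *\<^sub>R (x $ i + x $ j)) (- \<Omega>)}"
    by (auto simp: pair_region_def circ_self_alt edist_set_eq_infdist[OF False])
  also have "open \<dots>"
    by (intro open_Int open_config_in assms open_Collect_less continuous_intros) auto
  finally show ?thesis .
qed

subsection \<open>The inequality on one orbit\<close>

lemma smooth_has_derivative:
  "smooth \<phi> \<Longrightarrow> (\<phi> has_derivative frechet_derivative \<phi> (at x)) (at x)"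
  unfolding smooth_def using Ck.simps(2)[of 0 \<phi>] frechet_derivative_works
  by (auto simp: differentiable_on_def)

lemma smooth_continuous_derivative:
  "smooth \<phi> \<Longrightarrow> continuous_on UNIV (\<lambda>x. frechet_derivative \<phi> (at x) v)"
  unfolding smooth_def by (metis Ck.simps)

lemma smooth_continuous: "smooth \<phi> \<Longrightarrow> continuous_on UNIV \<phi>"
  unfolding smooth_def by (metis Ck.simps(1))

section \<open>The gauge potential in complex coordinates\<close>

definition cvec :: "real^2 \<Rightarrow> complex" where
  "cvec a = Complex (a $ 1) (a $ 2)"

lemma cvec_simps [simp]:
  "cvec (a + b) = cvec a + cvec b" "cvec (a - b) = cvec a - cvec b" "cvec (- a) = - cvec a"
  "cvec (c *\<^sub>R a) = of_real c * cvec a" "cvec (rot a) = \<i> * cvec a" "cvec 0 = 0"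
  by (simp_all add: cvec_def complex_eq_iff)

lemma norm_cvec [simp]: "norm (cvec a) = norm a"
  by (simp add: cvec_def cmod_def norm_vec_def L2_set_def sum_2)

lemma cvec_eq_0 [simp]: "cvec a = 0 \<longleftrightarrow> a = 0"
  by (metis norm_cvec norm_eq_zero)

text \<open>As a complex number \<open>vinv a\<close> is the conjugate of \<open>1 / a\<close>. This
  is the bridge from the anyonic potential to the simple poles integrated in
  \<open>vortex_pair_primitive\<close>.\<close>

lemma inner_vinv: "vinv a \<bullet> b = Re (cvec b / cvec a)"
proof -
  have n: "(norm a)\<^sup>2 = (a $ 1)\<^sup>2 + (a $ 2)\<^sup>2"
    unfolding power2_norm_eq_inner inner_vec2 by (simp add: power2_eq_square)
  show ?thesis
    by (simp add: vinv_def inner_vec2 n Re_divide cvec_def divide_inverse algebra_simps)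
qed

text \<open>
  The angular component of the gauge potential along the orbit of \<open>relrot i j\<close>; its integral over
  half a turn is \<open>(2 p + 1) \<alpha> \<pi>\<close>, where \<open>p\<close> counts the particles enclosed by the circle.
\<close>
definition gauge_rate :: "real \<Rightarrow> 'n::finite \<Rightarrow> 'n \<Rightarrow> 'n config \<Rightarrow> real" where
  "gauge_rate \<alpha> i j y = \<alpha> / 2 *
     (((\<Sum>k\<in>-{i}. rot (vinv (y $ i - y $ k))) - (\<Sum>k\<in>-{j}. rot (vinv (y $ j - y $ k)))) \<bullet> rot (y $ i - y $ j))"

text \<open>Seen from the midpoint and in doubled coordinates, the pair sits at \<open>c\<close> and
  \<open>- c\<close> with \<open>c = cis t * z\<close>, and particle \<open>k\<close> sits at
  \<open>w k\<close>. The doubling cancels the prefactor \<open>\<alpha> / 2\<close> in each term of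
  the sum. The summand 1 is the interaction of the pair with itself, one half from each
  partner.\<close>

lemma gauge_rate_relrot:
  fixes x :: "'n::finite config"
  assumes ij: "i \<noteq> j" and r: "x $ i \<noteq> x $ j"
  defines "z \<equiv> cvec (x $ i - x $ j)" and "w \<equiv> \<lambda>k. cvec (2 *\<^sub>R x $ k - (x $ i + x $ j))"
  shows "gauge_rate \<alpha> i j (relrot i j t x) = \<alpha> * (1 + (\<Sum>k\<in>-{i,j}.
     Re (cis t * z / (cis t * z - w k)) + Re (cis t * z / (cis t * z + w k))))"
proof -
  define y where "y = relrot i j t x"
  define c where "c = cis t * z"
  have z0: "z \<noteq> 0" using r by (simp add: z_def del: cvec_simps)
  then have c0: "c \<noteq> 0" by (simp add: c_def)
  have cij: "cvec (y $ i - y $ j) = c"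
    unfolding y_def relrot_diff[OF ij] by (simp add: c_def z_def cis.ctr complex_eq_iff algebra_simps)
  have ci: "cvec (y $ i - y $ k) = (c - w k) / 2" and cj: "cvec (y $ j - y $ k) = - ((c + w k) / 2)" if "k \<in> -{i,j}" for k
  proof -
    have k: "y $ k = x $ k" using that by (auto simp: y_def relrot_other)
    have s: "cvec (y $ i) + cvec (y $ j) = cvec (x $ i) + cvec (x $ j)"
      using arg_cong[OF relrot_sum[OF ij, of t x], of cvec] by (simp add: y_def)
    show "cvec (y $ i - y $ k) = (c - w k) / 2" "cvec (y $ j - y $ k) = - ((c + w k) / 2)"
      using s by (simp_all add: cij[symmetric] w_def k field_simps)
  qed
  have half: "Re (a / (b / 2)) = 2 * Re (a / b)" for a b :: complex
  proof -
    have "a / (b / 2) = of_real 2 * (a / b)" by simp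
    then show ?thesis by (simp only: Re_complex_of_real Im_complex_of_real times_complex.sel)
  qed
  have I: "(\<Sum>k\<in>-{i}. rot (vinv (y $ i - y $ k)) \<bullet> rot (y $ i - y $ j))
     = 1 + (\<Sum>k\<in>-{i,j}. 2 * Re (c / (c - w k)))"
  proof -
    have "-{i} = insert j (-{i,j})" using ij by auto
    then have "(\<Sum>k\<in>-{i}. rot (vinv (y $ i - y $ k)) \<bullet> rot (y $ i - y $ j))
      = Re (cvec (y $ i - y $ j) / cvec (y $ i - y $ j)) + (\<Sum>k\<in>-{i,j}. Re (cvec (y $ i - y $ j) / cvec (y $ i - y $ k)))"
      by (simp add: inner_vinv del: cvec_simps)
    also have "\<dots> = 1 + (\<Sum>k\<in>-{i,j}. 2 * Re (c / (c - w k)))"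
      unfolding cij by (intro arg_cong2[where f="(+)"] sum.cong refl) (simp_all only: ci half divide_self[OF c0] one_complex.sel)
    finally show ?thesis .
  qed
  have J: "(\<Sum>k\<in>-{j}. rot (vinv (y $ j - y $ k)) \<bullet> rot (y $ i - y $ j))
     = - (1 + (\<Sum>k\<in>-{i,j}. 2 * Re (c / (c + w k))))"
  proof -
    have "-{j} = insert i (-{i,j})" using ij by auto
    then have "(\<Sum>k\<in>-{j}. rot (vinv (y $ j - y $ k)) \<bullet> rot (y $ i - y $ j))
      = Re (cvec (y $ i - y $ j) / cvec (y $ j - y $ i)) + (\<Sum>k\<in>-{i,j}. Re (cvec (y $ i - y $ j) / cvec (y $ j - y $ k)))"
      by (simp add: inner_vinv del: cvec_simps)
    also have "cvec (y $ j - y $ i) = - c" using cij by (metis minus_diff_eq cvec_simps(3))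
    also have "Re (cvec (y $ i - y $ j) / - c) + (\<Sum>k\<in>-{i,j}. Re (cvec (y $ i - y $ j) / cvec (y $ j - y $ k)))
       = - 1 + (\<Sum>k\<in>-{i,j}. - (2 * Re (c / (c + w k))))"
      unfolding cij
      by (intro arg_cong2[where f="(+)"] sum.cong refl)
        (simp_all only: cj half divide_self[OF c0] one_complex.sel divide_minus_right uminus_complex.sel)
    finally show ?thesis by (simp add: sum_negf)
  qed
  show ?thesis
    unfolding gauge_rate_def y_def[symmetric] c_def[symmetric] inner_diff_left inner_sum_left I J sum.distrib
      sum_distrib_left[symmetric]
    by (simp add: field_simps)
qed

text \<open>The right-hand side is the covariant derivative along the orbit, up to a factor of
  modulus 2. The 2 comes from the orbit's velocity, which moves each particle by only half of
  \<open>\<rho>\<close>; squared, it is the 4 of the final constant.\<close>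

lemma cov_deriv_pair:
  fixes \<phi> :: "'n::finite config \<Rightarrow> complex" and y :: "'n config"
  assumes "smooth \<phi>" and ij: "i \<noteq> j"
  defines "\<rho> \<equiv> rot (y $ i - y $ j)"
  shows "(\<Sum>m\<in>UNIV. of_real (\<rho> $ m) * (cov_deriv_test \<alpha> i \<phi> y - cov_deriv_test \<alpha> j \<phi> y) $ m)
    = - 2 * \<i> * (frechet_derivative \<phi> (at y) ((1/2) *\<^sub>R (axis i \<rho> - axis j \<rho>)) + \<i> * gauge_rate \<alpha> i j y * \<phi> y)"
proof -
  let ?d = "frechet_derivative \<phi> (at y)"
  have L: "linear ?d"
    using smooth_has_derivative[OF assms(1)] has_derivative_linear by blast
  have ax: "axis l \<rho> = (\<Sum>m\<in>UNIV. (\<rho> $ m) *\<^sub>R axis l (axis m 1))" for l :: 'n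
    by (simp add: vec_eq_iff axis_def sum_2 forall_2)
  have d: "?d (axis l \<rho>) = (\<Sum>m\<in>UNIV. of_real (\<rho> $ m) * ?d (axis l (axis m 1)))" for l
    unfolding ax linear_sum[OF L] linear_scale[OF L] by (simp add: scaleR_conv_of_real)
  have dd: "?d ((1/2) *\<^sub>R (axis i \<rho> - axis j \<rho>)) = (?d (axis i \<rho>) - ?d (axis j \<rho>)) / 2"
    unfolding linear_scale[OF L] linear_diff[OF L] by (simp add: scaleR_conv_of_real)
  have g: "of_real (gauge_rate \<alpha> i j y) = (\<Sum>m\<in>UNIV. of_real (\<rho> $ m) * of_real (\<alpha> / 2 *
       ((\<Sum>k\<in>-{i}. rot (vinv (y $ i - y $ k)) $ m) - (\<Sum>k\<in>-{j}. rot (vinv (y $ j - y $ k)) $ m))) :: complex)"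
    unfolding gauge_rate_def \<rho>_def[symmetric] of_real_mult[symmetric] of_real_sum[symmetric] of_real_eq_iff
    by (simp add: inner_vec2 sum_2 algebra_simps)
  show ?thesis
    unfolding dd d g cov_deriv_test_def by (simp add: sum_2 field_simps)
qed

lemma norm_weighted_sum_le:
  fixes a :: "complex^2" and \<rho> :: "real^2"
  shows "(norm (\<Sum>m\<in>UNIV. of_real (\<rho> $ m) * a $ m))\<^sup>2 \<le> (norm \<rho>)\<^sup>2 * (norm a)\<^sup>2"
proof -
  have "norm (\<Sum>m\<in>UNIV. of_real (\<rho> $ m) * a $ m) \<le> (\<Sum>m\<in>UNIV. \<bar>norm (\<rho> $ m)\<bar> * \<bar>norm (a $ m)\<bar>)"
    by (rule sum_norm_le) (simp add: norm_mult)
  also have "\<dots> \<le> norm \<rho> * norm a"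
    unfolding norm_vec_def by (rule L2_set_mult_ineq)
  finally show ?thesis by (metis norm_ge_zero power_mono power_mult_distrib)
qed

text \<open>By Cauchy-Schwarz only the component of \<open>D_i - D_j\<close> along the circle is
  kept; the radial component is discarded here.\<close>

lemma cov_deriv_pair_ge:
  fixes \<phi> :: "'n::finite config \<Rightarrow> complex"
  assumes "smooth \<phi>" and ij: "i \<noteq> j"
  shows "4 * (norm (frechet_derivative \<phi> (at y) ((1/2) *\<^sub>R (axis i (rot (y $ i - y $ j)) - axis j (rot (y $ i - y $ j))))
      + \<i> * gauge_rate \<alpha> i j y * \<phi> y))\<^sup>2
    \<le> (norm (y $ i - y $ j))\<^sup>2 * (norm (cov_deriv_test \<alpha> i \<phi> y - cov_deriv_test \<alpha> j \<phi> y))\<^sup>2"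
  using norm_weighted_sum_le[of "rot (y $ i - y $ j)" "cov_deriv_test \<alpha> i \<phi> y - cov_deriv_test \<alpha> j \<phi> y"]
  unfolding cov_deriv_pair[OF assms] by (simp add: norm_mult power_mult_distrib)

lemma anyon_const_nonneg: "0 \<le> anyon_const \<alpha> N"
  unfolding anyon_const_def by (auto intro!: Min.boundedI cINF_greatest)

lemma anyon_const_le:
  assumes "p \<le> N - 2"
  shows "anyon_const \<alpha> N \<le> (INF q::int. \<bar>real (2 * p + 1) * \<alpha> - 2 * real_of_int q\<bar>)"
  unfolding anyon_const_def using assms by (intro Min_le) auto

text \<open>By Thales, \<open>gen\<close> says that no third particle lies on the circle whose
  diameter joins the pair, which is the circle the pair sweeps out. The potential is then continuous
  along the orbit and every other particle is strictly inside or strictly outside.\<close>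

lemma pair_circle_inequality:
  fixes \<phi> :: "'n::finite config \<Rightarrow> complex"
  assumes \<phi>: "\<phi> \<in> sym_test_functions" and ij: "i \<noteq> j" and r: "x $ i \<noteq> x $ j"
    and gen: "\<And>k. k \<noteq> i \<Longrightarrow> k \<noteq> j \<Longrightarrow> (x $ k - x $ i) \<bullet> (x $ k - x $ j) \<noteq> 0"
  shows "ennreal (4 * (anyon_const \<alpha> CARD('n))\<^sup>2) *
     (\<integral>\<^sup>+t\<in>{0..pi}. ennreal ((norm (\<phi> (relrot i j t x)))\<^sup>2 / (norm (x $ i - x $ j))\<^sup>2) \<partial>lborel)
   \<le> (\<integral>\<^sup>+t\<in>{0..pi}. ennreal ((norm (cov_deriv_test \<alpha> i \<phi> (relrot i j t x) - cov_deriv_test \<alpha> j \<phi> (relrot i j t x)))\<^sup>2) \<partial>lborel)"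
proof -
  have sm: "smooth \<phi>" and sym: "\<And>\<sigma> x. bij \<sigma> \<Longrightarrow> \<phi> (\<chi> j. x $ \<sigma> j) = \<phi> x"
    using \<phi> by (auto simp: sym_test_functions_def)
  define y where "y t = relrot i j t x" for t
  define f where "f t = \<phi> (y t)" for t
  define f' where "f' t = frechet_derivative \<phi> (at (y t)) ((1/2) *\<^sub>R (axis i (rot (y t $ i - y t $ j)) - axis j (rot (y t $ i - y t $ j))))" for t
  define a where "a t = gauge_rate \<alpha> i j (y t)" for t
  define z where "z = cvec (x $ i - x $ j)"
  define w where "w k = cvec (2 *\<^sub>R x $ k - (x $ i + x $ j))" for k
  have z0: "z \<noteq> 0" using r by (simp add: z_def del: cvec_simps)
  have wz: "norm (w k) \<noteq> norm z" if "k \<in> -{i,j}" for k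
  proof
    assume "norm (w k) = norm z"
    then have "(2 *\<^sub>R x $ k - (x $ i + x $ j)) \<bullet> (2 *\<^sub>R x $ k - (x $ i + x $ j)) = (x $ i - x $ j) \<bullet> (x $ i - x $ j)"
      unfolding w_def z_def norm_cvec by (simp add: norm_eq_sqrt_inner)
    then have "4 * ((x $ k - x $ i) \<bullet> (x $ k - x $ j)) = 0"
      by (simp add: inner_add_left inner_add_right inner_diff_left inner_diff_right inner_commute algebra_simps)
    with gen[of k] that show False by simp
  qed
  have "\<exists>F. (\<forall>t. (F has_real_derivative Re (cis t * z / (cis t * z - w k)) + Re (cis t * z / (cis t * z + w k))) (at t))
      \<and> F pi - F 0 = (if norm (w k) < norm z then 2 * pi else 0)" if "k \<in> -{i,j}" for k
    using vortex_pair_primitive[OF z0 wz[OF that]] by metis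
  then obtain F where F: "\<And>k t. k \<in> -{i,j} \<Longrightarrow> (F k has_real_derivative Re (cis t * z / (cis t * z - w k)) + Re (cis t * z / (cis t * z + w k))) (at t)"
      "\<And>k. k \<in> -{i,j} \<Longrightarrow> F k pi - F k 0 = (if norm (w k) < norm z then 2 * pi else 0)"
    by metis
  define \<Phi> where "\<Phi> t = \<alpha> * (t + (\<Sum>k\<in>-{i,j}. F k t))" for t
  define p where "p = card {k \<in> -{i,j}. norm (w k) < norm z}"
  have a: "a t = \<alpha> * (1 + (\<Sum>k\<in>-{i,j}. Re (cis t * z / (cis t * z - w k)) + Re (cis t * z / (cis t * z + w k))))" for t
    unfolding a_def y_def z_def w_def by (rule gauge_rate_relrot[OF ij r])
  have dP: "(\<Phi> has_real_derivative a t) (at t)" for t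
    unfolding \<Phi>_def a by (intro DERIV_cmult DERIV_add DERIV_ident DERIV_sum F)
  have ne: "cis t * z - w k \<noteq> 0" "cis t * z + w k \<noteq> 0" if "k \<in> -{i,j}" for t k
  proof -
    have n: "norm (cis t * z) = norm z" by (simp add: norm_mult)
    show "cis t * z - w k \<noteq> 0" using wz[OF that] n by auto
    show "cis t * z + w k \<noteq> 0" using wz[OF that] n by (metis add_eq_0_iff norm_minus_cancel)
  qed
  have ca: "continuous_on UNIV a"
    unfolding a by (intro continuous_intros ballI ne)
  have "\<Phi> pi - \<Phi> 0 = \<alpha> * (pi + (\<Sum>k\<in>-{i,j}. F k pi - F k 0))"
    by (simp add: \<Phi>_def sum_subtractf algebra_simps)
  also have "(\<Sum>k\<in>-{i,j}. F k pi - F k 0) = (\<Sum>k\<in>-{i,j}. if norm (w k) < norm z then 2 * pi else 0)"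
    by (intro sum.cong F) auto
  also have "\<dots> = 2 * pi * p"
    by (simp add: p_def sum.If_cases Int_def)
  finally have flux: "\<Phi> pi - \<Phi> 0 = pi * (real (2 * p + 1) * \<alpha>)"
    by (simp add: algebra_simps)
  \<comment> \<open>Enclosed particles are among the \<open>N - 2\<close> outside the pair, so this
    flux is one of those over which \<open>anyon_const\<close> takes the minimum.\<close>
  have "p \<le> card (-{i,j})" unfolding p_def by (intro card_mono) auto
  also have "\<dots> = CARD('n) - 2" using ij by (simp add: Compl_eq_Diff_UNIV card_Diff_subset)
  finally have pN: "p \<le> CARD('n) - 2" .
  have cy: "continuous_on S y" for S
    unfolding y_def using relrot_has_vector_derivative[OF ij]
    by (meson continuous_at_imp_continuous_on has_vector_derivative_continuous)
  have df: "(f has_vector_derivative f' t) (at t)" for t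
  proof -
    have "(y has_derivative (\<lambda>s. s *\<^sub>R ((1/2) *\<^sub>R (axis i (rot (y t $ i - y t $ j)) - axis j (rot (y t $ i - y t $ j)))))) (at t)"
      using relrot_has_vector_derivative[OF ij, of x t] unfolding y_def[symmetric] has_vector_derivative_def .
    from has_derivative_compose[OF this smooth_has_derivative[OF sm]]
    show ?thesis
      unfolding has_vector_derivative_def f_def f'_def
      using linear_scale[OF has_derivative_linear[OF smooth_has_derivative[OF sm]]] by simp
  qed
  have cf': "continuous_on UNIV f'"
  proof -
    \<comment> \<open>Smoothness gives continuity of the derivative in each fixed direction, so the
      moving direction is expanded in coordinate vectors.\<close>
    have "f' t = (\<Sum>m\<in>UNIV. (rot (y t $ i - y t $ j) $ m / 2) *\<^sub>R
       (frechet_derivative \<phi> (at (y t)) (axis i (axis m 1)) - frechet_derivative \<phi> (at (y t)) (axis j (axis m 1))))" for t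
    proof -
      let ?d = "frechet_derivative \<phi> (at (y t))" and ?r = "rot (y t $ i - y t $ j)"
      have L: "linear ?d"
        using smooth_has_derivative[OF sm] has_derivative_linear by blast
      have "(1/2) *\<^sub>R (axis i ?r - axis j ?r) = (\<Sum>m\<in>UNIV. (?r $ m / 2) *\<^sub>R (axis i (axis m 1) - axis j (axis m 1)))"
        by (simp add: vec_eq_iff axis_def sum_2 forall_2)
      then show ?thesis
        unfolding f'_def by (simp only: linear_sum[OF L] linear_scale[OF L] linear_diff[OF L])
    qed
    moreover have "continuous_on UNIV (\<lambda>t. rot (y t $ i - y t $ j))"
      by (intro continuous_on_rot continuous_intros cy)
    ultimately show ?thesis
      by (auto intro!: continuous_intros continuous_on_compose2[OF smooth_continuous_derivative[OF sm] cy])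
  qed
  have per: "f pi = f 0"
    unfolding f_def y_def relrot_0 relrot_pi[OF ij] using ij by (intro sym) (auto simp: bij_swap_iff)
  have cf: "continuous_on S f" for S
    using df by (meson continuous_at_imp_continuous_on has_vector_derivative_continuous)
  let ?R = "(norm (x $ i - x $ j))\<^sup>2"
  have R: "?R > 0" using r by simp
  let ?C = "anyon_const \<alpha> CARD('n)"
  have i1: "(\<lambda>t. (norm (f t))\<^sup>2) integrable_on {0..pi}" and i2: "(\<lambda>t. (norm (f' t + \<i> * a t * f t))\<^sup>2) integrable_on {0..pi}"
    by (auto intro!: integrable_continuous_interval continuous_intros cf continuous_on_subset[OF cf'] continuous_on_subset[OF ca])
  have p1: "0 \<le> integral {0..pi} (\<lambda>t. (norm (f t))\<^sup>2)"
    by (intro integral_nonneg i1) auto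
  have "?C\<^sup>2 * integral {0..pi} (\<lambda>t. (norm (f t))\<^sup>2) \<le>
     (INF q::int. \<bar>real (2 * p + 1) * \<alpha> - 2 * real_of_int q\<bar>)\<^sup>2 * integral {0..pi} (\<lambda>t. (norm (f t))\<^sup>2)"
    by (intro mult_right_mono power_mono anyon_const_le pN anyon_const_nonneg p1)
  also have "\<dots> \<le> integral {0..pi} (\<lambda>t. (norm (f' t + \<i> * a t * f t))\<^sup>2)"
    by (rule gauged_wirtinger[OF df cf' per dP ca flux])
  finally have main: "?C\<^sup>2 * integral {0..pi} (\<lambda>t. (norm (f t))\<^sup>2) \<le> integral {0..pi} (\<lambda>t. (norm (f' t + \<i> * a t * f t))\<^sup>2)" .
  have "(\<integral>\<^sup>+t\<in>{0..pi}. ennreal ((norm (f t))\<^sup>2 / ?R) \<partial>lborel) = ennreal (integral {0..pi} (\<lambda>t. (norm (f t))\<^sup>2) / ?R)"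
    by (intro nn_integral_has_integral_lebesgue' has_integral_divide integrable_integral i1) auto
  then have "ennreal (4 * ?C\<^sup>2) * (\<integral>\<^sup>+t\<in>{0..pi}. ennreal ((norm (f t))\<^sup>2 / ?R) \<partial>lborel)
      = ennreal (4 / ?R * (?C\<^sup>2 * integral {0..pi} (\<lambda>t. (norm (f t))\<^sup>2)))"
    using p1 by (simp add: ennreal_mult[symmetric])
  also have "\<dots> \<le> ennreal (4 / ?R * integral {0..pi} (\<lambda>t. (norm (f' t + \<i> * a t * f t))\<^sup>2))"
    using R by (intro ennreal_leI mult_left_mono main) auto
  also have "\<dots> = (\<integral>\<^sup>+t\<in>{0..pi}. ennreal (4 / ?R * (norm (f' t + \<i> * a t * f t))\<^sup>2) \<partial>lborel)"
    by (intro nn_integral_has_integral_lebesgue'[symmetric] has_integral_mult_right integrable_integral i2) auto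
  also have "\<dots> \<le> (\<integral>\<^sup>+t\<in>{0..pi}. ennreal ((norm (cov_deriv_test \<alpha> i \<phi> (y t) - cov_deriv_test \<alpha> j \<phi> (y t)))\<^sup>2) \<partial>lborel)"
  proof (intro nn_integral_mono mult_right_mono ennreal_leI)
    fix t
    have "norm (y t $ i - y t $ j) = norm (x $ i - x $ j)" by (simp add: y_def norm_relrot_diff[OF ij])
    then show "4 / ?R * (norm (f' t + \<i> * a t * f t))\<^sup>2 \<le> (norm (cov_deriv_test \<alpha> i \<phi> (y t) - cov_deriv_test \<alpha> j \<phi> (y t)))\<^sup>2"
      using cov_deriv_pair_ge[OF sm ij, of "y t" \<alpha>] R by (simp add: f_def f'_def a_def field_simps)
  qed auto
  finally show ?thesis by (simp add: f_def y_def)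
qed

subsection \<open>The inequality for test functions\<close>

text \<open>Each rotation preserves the integral, so by Fubini integrating the orbit integrals gives
  \<open>pi\<close> times the original integral. The factor cancels in \<open>ennreal\<close>
  because it is neither 0 nor infinite.\<close>

lemma relrot_average_mono:
  fixes F G :: "'n::finite config \<Rightarrow> ennreal"
  assumes ij: "i \<noteq> j" and [measurable]: "F \<in> borel_measurable borel" "G \<in> borel_measurable borel"
    and le: "AE x in lborel. (\<integral>\<^sup>+t\<in>{0..pi}. G (relrot i j t x) \<partial>lborel) \<le> (\<integral>\<^sup>+t\<in>{0..pi}. F (relrot i j t x) \<partial>lborel)"
  shows "(\<integral>\<^sup>+x. G x \<partial>lborel) \<le> (\<integral>\<^sup>+x. F x \<partial>lborel)"
proof -
  have avg: "ennreal pi * (\<integral>\<^sup>+x. H x \<partial>lborel) = (\<integral>\<^sup>+x. (\<integral>\<^sup>+t\<in>{0..pi}. H (relrot i j t x) \<partial>lborel) \<partial>lborel)"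
    if [measurable]: "H \<in> borel_measurable borel" for H :: "'n config \<Rightarrow> ennreal"
  proof -
    have [measurable]: "(\<lambda>(t, x). relrot i j t x) \<in> borel_measurable (lborel \<Otimes>\<^sub>M lborel)"
      using borel_measurable_continuous_onI[OF continuous_relrot[of i j]] by (simp add: lborel_prod)
    have [measurable]: "relrot i j t \<in> borel_measurable borel" for t
      using orthogonal_transformation_linear[OF orthogonal_relrot[OF ij]]
      by (intro borel_measurable_continuous_onI linear_continuous_on) (simp add: linear_conv_bounded_linear)
    have "ennreal pi * (\<integral>\<^sup>+x. H x \<partial>lborel) = (\<integral>\<^sup>+t. indicator {0..pi} t * (\<integral>\<^sup>+x. H x \<partial>lborel) \<partial>lborel)"
      by (simp add: nn_integral_multc)
    also have "\<dots> = (\<integral>\<^sup>+t. indicator {0..pi} t * (\<integral>\<^sup>+x. H (relrot i j t x) \<partial>lborel) \<partial>lborel)"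
    proof (rule nn_integral_cong)
      fix t
      have "(\<integral>\<^sup>+x. H x \<partial>lborel) = (\<integral>\<^sup>+x. H x \<partial>distr lborel borel (relrot i j t))"
        using lborel_distr_orthogonal_transformation[OF orthogonal_relrot[OF ij]] by simp
      also have "\<dots> = (\<integral>\<^sup>+x. H (relrot i j t x) \<partial>lborel)"
        by (subst nn_integral_distr) auto
      finally show "indicator {0..pi} t * (\<integral>\<^sup>+x. H x \<partial>lborel) = indicator {0..pi} t * (\<integral>\<^sup>+x. H (relrot i j t x) \<partial>lborel)"
        by simp
    qed
    also have "\<dots> = (\<integral>\<^sup>+t. (\<integral>\<^sup>+x. H (relrot i j t x) * indicator {0..pi} t \<partial>lborel) \<partial>lborel)"
    proof (rule nn_integral_cong)
      fix t
      show "indicator {0..pi} t * (\<integral>\<^sup>+x. H (relrot i j t x) \<partial>lborel) = (\<integral>\<^sup>+x. H (relrot i j t x) * indicator {0..pi} t \<partial>lborel)"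
        by (subst nn_integral_multc) (simp_all add: mult.commute)
    qed
    also have "\<dots> = (\<integral>\<^sup>+x. (\<integral>\<^sup>+t\<in>{0..pi}. H (relrot i j t x) \<partial>lborel) \<partial>lborel)"
      by (rule lborel_pair.Fubini'[symmetric]) measurable
    finally show ?thesis .
  qed
  have "ennreal pi * (\<integral>\<^sup>+x. G x \<partial>lborel) \<le> ennreal pi * (\<integral>\<^sup>+x. F x \<partial>lborel)"
    by (simp add: avg nn_integral_mono_AE[OF le])
  then show ?thesis
    by (simp add: ennreal_mult_le_mult_iff)
qed

text \<open>Fubini in the direction \<open>e\<close> without splitting the space: translation
  invariance lets the measure of the bad set be averaged over its shifts by
  \<open>t *\<^sub>R e\<close> with \<open>t\<close> in the unit interval, and after exchanging the
  integrals each line contributes a finite set.\<close>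

lemma AE_lborel_line:
  fixes P :: "'a::euclidean_space \<Rightarrow> bool" and e :: 'a
  assumes [measurable]: "Measurable.pred borel P"
    and fin: "\<And>x. finite {t. \<not> P (x + t *\<^sub>R e)}"
  shows "AE x in lborel. P x"
proof -
  let ?h = "\<lambda>x. indicator {x. \<not> P x} x :: ennreal"
  have inv: "(\<integral>\<^sup>+x. ?h (x + t *\<^sub>R e) \<partial>lborel) = (\<integral>\<^sup>+x. ?h x \<partial>lborel)" for t
    using nn_integral_lborel_shift[of ?h "t *\<^sub>R e"] by (simp add: add.commute)
  have "(\<integral>\<^sup>+x. ?h x \<partial>lborel) = (\<integral>\<^sup>+t. indicator {0..1::real} t * (\<integral>\<^sup>+x. ?h x \<partial>lborel) \<partial>lborel)"
    by (simp add: nn_integral_multc)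
  also have "\<dots> = (\<integral>\<^sup>+t. (\<integral>\<^sup>+x. indicator {0..1::real} t * ?h (x + t *\<^sub>R e) \<partial>lborel) \<partial>lborel)"
  proof (rule nn_integral_cong)
    fix t :: real
    show "indicator {0..1} t * (\<integral>\<^sup>+x. ?h x \<partial>lborel) = (\<integral>\<^sup>+x. indicator {0..1} t * ?h (x + t *\<^sub>R e) \<partial>lborel)"
      unfolding inv[of t, symmetric] by (rule nn_integral_cmult[symmetric]) measurable
  qed
  also have "\<dots> = (\<integral>\<^sup>+x. (\<integral>\<^sup>+t. indicator {0..1::real} t * ?h (x + t *\<^sub>R e) \<partial>lborel) \<partial>lborel)"
    by (rule lborel_pair.Fubini'[symmetric]) measurable
  also have "\<dots> = (\<integral>\<^sup>+x. 0 \<partial>(lborel :: 'a measure))"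
  proof (rule nn_integral_cong)
    fix x :: 'a
    have "AE t in lborel. t \<notin> {t. \<not> P (x + t *\<^sub>R e)}"
      by (intro AE_not_in finite_imp_null_set_lborel fin)
    then show "(\<integral>\<^sup>+t. indicator {0..1::real} t * ?h (x + t *\<^sub>R e) \<partial>lborel) = 0"
      by (subst nn_integral_0_iff_AE) (auto simp: indicator_def)
  qed
  finally have "(\<integral>\<^sup>+x. ?h x \<partial>lborel) = 0" by simp
  then show ?thesis
    by (subst (asm) nn_integral_0_iff_AE) (auto simp: indicator_def split: if_splits)
qed

lemma finite_quadratic_zeros:
  fixes a b :: real
  shows "finite {t. t\<^sup>2 + b * t + a = 0}"
proof -
  have "{t. t\<^sup>2 + b * t + a = 0} = {t. poly [:a, b, 1:] t = 0}"
    by (auto simp: power2_eq_square algebra_simps)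
  then show ?thesis using poly_roots_finite[of "[:a, b, 1:]"] by simp
qed

lemma AE_off_collision_circles:
  "AE x :: 'n::finite config in lborel. \<forall>k. k \<noteq> i \<longrightarrow> k \<noteq> j \<longrightarrow> (x $ k - x $ i) \<bullet> (x $ k - x $ j) \<noteq> 0"
proof -
  have "AE x :: 'n config in lborel. (x $ k - x $ i) \<bullet> (x $ k - x $ j) \<noteq> 0" if k: "k \<noteq> i" "k \<noteq> j" for k
  \<comment> \<open>Moving particle \<open>k\<close> along the first axis changes the inner product
    by a quadratic in \<open>t\<close> with leading coefficient 1, so it has finitely many zeros
    whatever the configuration.\<close>
  proof (rule AE_lborel_line[of _ "axis k (axis 1 1)"])
    show "Measurable.pred borel (\<lambda>x :: 'n config. (x $ k - x $ i) \<bullet> (x $ k - x $ j) \<noteq> 0)"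
      unfolding pred_def by (simp, intro borel_open open_Collect_neq continuous_intros)
    fix x :: "'n config"
    define p q where "p = x $ k - x $ i" and "q = x $ k - x $ j"
    have "((x + t *\<^sub>R axis k (axis 1 1)) $ k - (x + t *\<^sub>R axis k (axis 1 1)) $ i) \<bullet>
       ((x + t *\<^sub>R axis k (axis 1 1)) $ k - (x + t *\<^sub>R axis k (axis 1 1)) $ j) = t\<^sup>2 + (p $ 1 + q $ 1) * t + p \<bullet> q" for t
      using k by (simp add: p_def q_def inner_vec2 axis_def power2_eq_square algebra_simps)
    then show "finite {t. \<not> ((x + t *\<^sub>R axis k (axis 1 1)) $ k - (x + t *\<^sub>R axis k (axis 1 1)) $ i) \<bullet>
       ((x + t *\<^sub>R axis k (axis 1 1)) $ k - (x + t *\<^sub>R axis k (axis 1 1)) $ j) \<noteq> 0}"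
      by (simp add: finite_quadratic_zeros)
  qed
  then have "AE x :: 'n config in lborel. \<forall>k\<in>-{i,j}. (x $ k - x $ i) \<bullet> (x $ k - x $ j) \<noteq> 0"
    by (intro AE_finite_allI) auto
  then show ?thesis by (rule AE_mp) auto
qed

lemma borel_measurable_vec_lambda:
  fixes f :: "'a \<Rightarrow> 'n::finite \<Rightarrow> 'b::euclidean_space"
  assumes "\<And>i. (\<lambda>x. f x i) \<in> borel_measurable M"
  shows "(\<lambda>x. \<chi> i. f x i) \<in> borel_measurable M"
proof (rule borel_measurable_euclidean_space[THEN iffD2, rule_format])
  fix b :: "'b^'n" assume "b \<in> Basis"
  then obtain i c where "b = axis i c" by (auto simp: Basis_vec_def)
  then show "(\<lambda>x. (\<chi> i. f x i) \<bullet> b) \<in> borel_measurable M"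
    using assms[of i] by (simp add: inner_axis)
qed

lemma borel_measurable_cov_deriv_test:
  fixes \<phi> :: "'n::finite config \<Rightarrow> complex"
  assumes sm: "smooth \<phi>"
  shows "cov_deriv_test \<alpha> j \<phi> \<in> borel_measurable borel"
proof -
  have [measurable]: "\<phi> \<in> borel_measurable borel" "(\<lambda>x. frechet_derivative \<phi> (at x) v) \<in> borel_measurable borel" for v
    using sm by (auto intro!: borel_measurable_continuous_onI smooth_continuous smooth_continuous_derivative)
  have [measurable]: "rot \<in> borel_measurable borel"
    by (intro borel_measurable_continuous_onI continuous_on_rot continuous_on_id)
  have [measurable]: "vinv \<in> borel_measurable borel"
    unfolding vinv_def[abs_def] by measurable
  have nth: "(\<lambda>x::real^2. x $ m) \<in> borel_measurable borel" for m
    by (intro borel_measurable_continuous_onI continuous_intros)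
  have [measurable]: "(\<lambda>x::'n config. x $ m) \<in> borel_measurable borel" for m
    by (intro borel_measurable_continuous_onI continuous_intros)
  have [measurable]: "(\<lambda>x::'n config. rot (vinv (x $ j - x $ k)) $ m) \<in> borel_measurable borel" for k m
    by (rule measurable_compose[OF _ nth]) measurable
  show ?thesis
    unfolding cov_deriv_test_def[abs_def] by (intro borel_measurable_vec_lambda) measurable
qed

lemma pair_hardy:
  fixes \<phi> :: "'n::finite config \<Rightarrow> complex"
  assumes \<phi>: "\<phi> \<in> sym_test_functions" and ij: "i \<noteq> j" and "open \<Omega>"
  shows "ennreal (4 * (anyon_const \<alpha> CARD('n))\<^sup>2) *
     (\<integral>\<^sup>+x\<in>pair_region \<Omega> i j. ennreal ((norm (\<phi> x))\<^sup>2 / (norm (x $ i - x $ j))\<^sup>2) \<partial>lborel)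
   \<le> (\<integral>\<^sup>+x\<in>pair_region \<Omega> i j. ennreal ((norm (cov_deriv_test \<alpha> i \<phi> x - cov_deriv_test \<alpha> j \<phi> x))\<^sup>2) \<partial>lborel)"
proof -
  have sm: "smooth \<phi>" using \<phi> by (auto simp: sym_test_functions_def)
  let ?S = "pair_region \<Omega> i j :: 'n config set"
  let ?c = "ennreal (4 * (anyon_const \<alpha> CARD('n))\<^sup>2)"
  let ?g = "\<lambda>x::'n config. ennreal ((norm (\<phi> x))\<^sup>2 / (norm (x $ i - x $ j))\<^sup>2)"
  let ?f = "\<lambda>x::'n config. ennreal ((norm (cov_deriv_test \<alpha> i \<phi> x - cov_deriv_test \<alpha> j \<phi> x))\<^sup>2)"
  have [measurable]: "\<phi> \<in> borel_measurable borel"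
    by (intro borel_measurable_continuous_onI smooth_continuous sm)
  have [measurable]: "(\<lambda>x::'n config. x $ m) \<in> borel_measurable borel" for m
    by (intro borel_measurable_continuous_onI continuous_intros)
  have [measurable]: "?S \<in> sets borel"
    using open_pair_region[OF \<open>open \<Omega>\<close>] by (rule borel_open)
  note [measurable] = borel_measurable_cov_deriv_test[OF sm]
  have "(\<integral>\<^sup>+x. ?c * (?g x * indicator ?S x) \<partial>lborel) \<le> (\<integral>\<^sup>+x. ?f x * indicator ?S x \<partial>lborel)"
  proof (rule relrot_average_mono[OF ij])
    show "AE x in lborel. (\<integral>\<^sup>+t\<in>{0..pi}. ?c * (?g (relrot i j t x) * indicator ?S (relrot i j t x)) \<partial>lborel)
        \<le> (\<integral>\<^sup>+t\<in>{0..pi}. ?f (relrot i j t x) * indicator ?S (relrot i j t x) \<partial>lborel)"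
      using AE_off_collision_circles[of i j]
    proof (rule AE_mp, intro AE_I2 impI)
      fix x :: "'n config"
      assume gen: "\<forall>k. k \<noteq> i \<longrightarrow> k \<noteq> j \<longrightarrow> (x $ k - x $ i) \<bullet> (x $ k - x $ j) \<noteq> 0"
      have [measurable]: "(\<lambda>t. relrot i j t x) \<in> borel_measurable borel"
        using relrot_has_vector_derivative[OF ij]
        by (intro borel_measurable_continuous_onI) (meson continuous_at_imp_continuous_on has_vector_derivative_continuous)
      have I: "indicator ?S (relrot i j t x) = (indicator ?S x :: ennreal)" for t
        by (simp add: indicator_def relrot_pair_region[OF ij])
      show "(\<integral>\<^sup>+t\<in>{0..pi}. ?c * (?g (relrot i j t x) * indicator ?S (relrot i j t x)) \<partial>lborel)
        \<le> (\<integral>\<^sup>+t\<in>{0..pi}. ?f (relrot i j t x) * indicator ?S (relrot i j t x) \<partial>lborel)"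
      \<comment> \<open>If the pair coincides, the quotient in \<open>?g\<close> is a division by
        zero and equals 0 along the whole orbit; outside the region the indicator vanishes along the
        whole orbit.\<close>
      proof (cases "x $ i = x $ j \<or> x \<notin> ?S")
        case True
        then show ?thesis by (auto simp: I norm_relrot_diff[OF ij])
      next
        case False
        have "(\<integral>\<^sup>+t\<in>{0..pi}. ?c * (?g (relrot i j t x) * indicator ?S (relrot i j t x)) \<partial>lborel)
          = ?c * (\<integral>\<^sup>+t\<in>{0..pi}. ?g (relrot i j t x) \<partial>lborel)"
          using False by (simp add: I nn_integral_cmult mult.assoc)
        also have "\<dots> \<le> (\<integral>\<^sup>+t\<in>{0..pi}. ?f (relrot i j t x) \<partial>lborel)"
          using pair_circle_inequality[OF \<phi> ij, of x \<alpha>] False gen by (simp add: norm_relrot_diff[OF ij])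
        finally show ?thesis using False by (simp add: I)
      qed
    qed
  qed measurable
  then show ?thesis by (simp add: nn_integral_cmult)
qed

text \<open>Summed over ordered pairs, the two sides differ by
  \<open>2 * (norm (sum d UNIV))^2\<close>, the centre-of-mass part, which is dropped. The factor
  \<open>N\<close> here becomes the \<open>1/N\<close> of the theorem.\<close>

lemma sum_norm_pairs_le:
  fixes d :: "'n::{finite,linorder} \<Rightarrow> 'a::real_inner"
  shows "(\<Sum>(i, j)\<in>{(i, j). i < j}. (norm (d i - d j))\<^sup>2) \<le> real CARD('n) * (\<Sum>j\<in>UNIV. (norm (d j))\<^sup>2)"
proof -
  let ?f = "\<lambda>(i, j). (norm (d i - d j))\<^sup>2"
  have "(\<Sum>i\<in>UNIV. \<Sum>j\<in>UNIV. (norm (d i - d j))\<^sup>2)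
     = (\<Sum>i\<in>UNIV. \<Sum>j\<in>UNIV. (norm (d i))\<^sup>2 + (norm (d j))\<^sup>2 - 2 * (d i \<bullet> d j))"
    by (simp add: power2_norm_eq_inner inner_diff_left inner_diff_right inner_commute algebra_simps)
  also have "\<dots> = 2 * real CARD('n) * (\<Sum>j\<in>UNIV. (norm (d j))\<^sup>2) - 2 * ((\<Sum>j\<in>UNIV. d j) \<bullet> (\<Sum>j\<in>UNIV. d j))"
    by (simp add: sum.distrib sum_subtractf inner_sum_left inner_sum_right sum_distrib_left[symmetric])
      (rule sum.swap)
  also have "\<dots> \<le> 2 * real CARD('n) * (\<Sum>j\<in>UNIV. (norm (d j))\<^sup>2)" by simp
  finally have 1: "(\<Sum>i\<in>UNIV. \<Sum>j\<in>UNIV. (norm (d i - d j))\<^sup>2) \<le> 2 * real CARD('n) * (\<Sum>j\<in>UNIV. (norm (d j))\<^sup>2)" .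
  have "sum ?f {(i, j). j < i} = sum ?f {(i, j). i < j}"
    by (rule sum.reindex_bij_witness[of _ prod.swap prod.swap]) (auto simp: norm_minus_commute)
  then have "2 * sum ?f {(i, j). i < j} = sum ?f {(i, j). i < j} + sum ?f {(i, j). j < i}" by simp
  also have "\<dots> = sum ?f ({(i, j). i < j} \<union> {(i, j). j < i})"
    by (rule sum.union_disjoint[symmetric]) auto
  also have "\<dots> \<le> sum ?f (UNIV \<times> UNIV)"
    by (rule sum_mono2) auto
  also have "\<dots> = (\<Sum>i\<in>UNIV. \<Sum>j\<in>UNIV. (norm (d i - d j))\<^sup>2)"
    by (simp add: sum.cartesian_product)
  finally show ?thesis using 1 by simp
qed

text \<open>Real-valued on purpose: terms with coinciding particles are 0 by division by zero, so
  the weight is finite at every point, although unbounded near coincidences. Truncations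
  \<open>min (W x) M\<close> therefore reach it pointwise.\<close>

definition hardy_weight :: "(real^2) set \<Rightarrow> 'n::{finite,linorder} config \<Rightarrow> real" where
  "hardy_weight \<Omega> x = (\<Sum>(i, j)\<in>{(i, j). i < j}. indicator (circ_self \<Omega>) (x $ i, x $ j) / (norm (x $ i - x $ j))\<^sup>2)"

lemma hardy_weight_nonneg: "0 \<le> hardy_weight \<Omega> x"
  unfolding hardy_weight_def by (intro sum_nonneg) auto

lemma hardy_test_function:
  fixes \<phi> :: "'n::{finite,linorder} config \<Rightarrow> complex"
  assumes \<phi>: "\<phi> \<in> sym_test_functions" and "open \<Omega>"
  shows "ennreal (4 * (anyon_const \<alpha> CARD('n))\<^sup>2 / real CARD('n)) *
     (\<integral>\<^sup>+x\<in>config_in \<Omega>. ennreal (hardy_weight \<Omega> x * (norm (\<phi> x))\<^sup>2) \<partial>lborel)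
   \<le> (\<integral>\<^sup>+x\<in>config_in \<Omega>. ennreal (\<Sum>j\<in>UNIV. (norm (cov_deriv_test \<alpha> j \<phi> x))\<^sup>2) \<partial>lborel)"
proof -
  have sm: "smooth \<phi>" using \<phi> by (auto simp: sym_test_functions_def)
  let ?P = "{(i, j). i < j} :: ('n \<times> 'n) set"
  let ?C = "4 * (anyon_const \<alpha> CARD('n))\<^sup>2"
  have [measurable]: "\<phi> \<in> borel_measurable borel"
    by (intro borel_measurable_continuous_onI smooth_continuous sm)
  have [measurable]: "(\<lambda>x::'n config. x $ m) \<in> borel_measurable borel" for m
    by (intro borel_measurable_continuous_onI continuous_intros)
  have [measurable]: "pair_region \<Omega> i j \<in> sets (borel :: 'n config measure)" for i j
    using open_pair_region[OF \<open>open \<Omega>\<close>] by (rule borel_open)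
  have [measurable]: "config_in \<Omega> \<in> sets (borel :: 'n config measure)"
    using open_config_in[OF \<open>open \<Omega>\<close>] by (rule borel_open)
  note [measurable] = borel_measurable_cov_deriv_test[OF sm]
  let ?g = "\<lambda>i j x. ennreal ((norm (\<phi> x))\<^sup>2 / (norm (x $ i - x $ j))\<^sup>2)"
  let ?f = "\<lambda>i j x. ennreal ((norm (cov_deriv_test \<alpha> i \<phi> x - cov_deriv_test \<alpha> j \<phi> x))\<^sup>2)"
  have "(\<integral>\<^sup>+x\<in>config_in \<Omega>. ennreal (hardy_weight \<Omega> x * (norm (\<phi> x))\<^sup>2) \<partial>lborel)
      = (\<integral>\<^sup>+x. (\<Sum>(i, j)\<in>?P. ?g i j x * indicator (pair_region \<Omega> i j) x) \<partial>lborel)"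
  proof (rule nn_integral_cong)
    fix x :: "'n config"
    have e: "ennreal (hardy_weight \<Omega> x * (norm (\<phi> x))\<^sup>2)
       = (\<Sum>p\<in>?P. ennreal (indicator (circ_self \<Omega>) (x $ fst p, x $ snd p) / (norm (x $ fst p - x $ snd p))\<^sup>2 * (norm (\<phi> x))\<^sup>2))"
      unfolding hardy_weight_def sum_distrib_right case_prod_unfold
      by (rule sum_ennreal[symmetric]) simp
    show "ennreal (hardy_weight \<Omega> x * (norm (\<phi> x))\<^sup>2) * indicator (config_in \<Omega>) x
       = (\<Sum>(i, j)\<in>?P. ?g i j x * indicator (pair_region \<Omega> i j) x)"
      unfolding e sum_distrib_right case_prod_unfold
      by (rule sum.cong) (auto simp: pair_region_def indicator_def)
  qed
  also have "\<dots> = (\<Sum>(i, j)\<in>?P. (\<integral>\<^sup>+x\<in>pair_region \<Omega> i j. ?g i j x \<partial>lborel))"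
    unfolding case_prod_unfold by (rule nn_integral_sum) measurable
  finally have "ennreal ?C * (\<integral>\<^sup>+x\<in>config_in \<Omega>. ennreal (hardy_weight \<Omega> x * (norm (\<phi> x))\<^sup>2) \<partial>lborel)
      = (\<Sum>(i, j)\<in>?P. ennreal ?C * (\<integral>\<^sup>+x\<in>pair_region \<Omega> i j. ?g i j x \<partial>lborel))"
    by (simp add: sum_distrib_left case_prod_unfold)
  also have "\<dots> \<le> (\<Sum>(i, j)\<in>?P. (\<integral>\<^sup>+x\<in>pair_region \<Omega> i j. ?f i j x \<partial>lborel))"
    by (intro sum_mono) (auto intro!: pair_hardy[OF \<phi> _ \<open>open \<Omega>\<close>])
  also have "\<dots> = (\<integral>\<^sup>+x. (\<Sum>(i, j)\<in>?P. ?f i j x * indicator (pair_region \<Omega> i j) x) \<partial>lborel)"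
    unfolding case_prod_unfold by (rule nn_integral_sum[symmetric]) measurable
  also have "\<dots> \<le> (\<integral>\<^sup>+x. ennreal (real CARD('n)) * (ennreal (\<Sum>j\<in>UNIV. (norm (cov_deriv_test \<alpha> j \<phi> x))\<^sup>2) * indicator (config_in \<Omega>) x) \<partial>lborel)"
  proof (rule nn_integral_mono)
    fix x :: "'n config"
    have "(\<Sum>(i, j)\<in>?P. ?f i j x * indicator (pair_region \<Omega> i j) x) \<le> (\<Sum>(i, j)\<in>?P. ?f i j x * indicator (config_in \<Omega>) x)"
      by (intro sum_mono) (auto simp: pair_region_def indicator_def)
    also have "\<dots> = ennreal (\<Sum>(i, j)\<in>?P. (norm (cov_deriv_test \<alpha> i \<phi> x - cov_deriv_test \<alpha> j \<phi> x))\<^sup>2) * indicator (config_in \<Omega>) x"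
      by (simp add: case_prod_unfold sum_distrib_right[symmetric] sum_ennreal)
    also have "\<dots> \<le> ennreal (real CARD('n) * (\<Sum>j\<in>UNIV. (norm (cov_deriv_test \<alpha> j \<phi> x))\<^sup>2)) * indicator (config_in \<Omega>) x"
      by (intro mult_right_mono ennreal_leI sum_norm_pairs_le) auto
    finally show "(\<Sum>(i, j)\<in>?P. ?f i j x * indicator (pair_region \<Omega> i j) x)
      \<le> ennreal (real CARD('n)) * (ennreal (\<Sum>j\<in>UNIV. (norm (cov_deriv_test \<alpha> j \<phi> x))\<^sup>2) * indicator (config_in \<Omega>) x)"
      by (simp add: ennreal_mult sum_nonneg mult.assoc)
  qed
  also have "\<dots> = ennreal (real CARD('n)) * (\<integral>\<^sup>+x\<in>config_in \<Omega>. ennreal (\<Sum>j\<in>UNIV. (norm (cov_deriv_test \<alpha> j \<phi> x))\<^sup>2) \<partial>lborel)"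
    by (intro nn_integral_cmult) measurable
  finally have "ennreal (1 / real CARD('n)) * (ennreal ?C * (\<integral>\<^sup>+x\<in>config_in \<Omega>. ennreal (hardy_weight \<Omega> x * (norm (\<phi> x))\<^sup>2) \<partial>lborel))
     \<le> ennreal (1 / real CARD('n)) * (ennreal (real CARD('n)) * (\<integral>\<^sup>+x\<in>config_in \<Omega>. ennreal (\<Sum>j\<in>UNIV. (norm (cov_deriv_test \<alpha> j \<phi> x))\<^sup>2) \<partial>lborel))"
    by (rule mult_left_mono) simp
  then show ?thesis
    by (simp add: mult.assoc[symmetric] ennreal_mult[symmetric])
qed

subsection \<open>Completeness of the space of square-integrable functions\<close>

text \<open>Young's inequality for the cross term. The factor at \<open>a\<close> can be taken
  arbitrarily close to 1, so that no constant is lost when \<open>u\<close> is approximated.\<close>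

lemma norm_add_sq_le:
  fixes a b :: "'a::real_normed_vector"
  assumes "e > 0"
  shows "(norm (a + b))\<^sup>2 \<le> (1 + e) * (norm a)\<^sup>2 + (1 + 1/e) * (norm b)\<^sup>2"
proof -
  have "(norm (a + b))\<^sup>2 \<le> (norm a + norm b)\<^sup>2"
    by (intro power_mono norm_triangle_ineq) auto
  also have "\<dots> \<le> (1 + e) * (norm a)\<^sup>2 + (1 + 1/e) * (norm b)\<^sup>2"
  proof -
    have "0 \<le> (e * norm a - norm b)\<^sup>2 / e" using assms by simp
    also have "\<dots> = e * (norm a)\<^sup>2 + (norm b)\<^sup>2 / e - 2 * norm a * norm b"
      using assms by (simp add: power2_eq_square field_simps)
    finally show ?thesis by (simp add: power2_eq_square algebra_simps)
  qed
  finally show ?thesis .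
qed

text \<open>Exchanges \<open>f\<close> for \<open>g\<close> in a weighted norm, with an error
  measured in unweighted \<open>L2\<close>. The error needs the weight to be bounded by
  \<open>M\<close>, which is the reason for truncating the Hardy weight.\<close>

lemma nn_integral_weighted_sq_le:
  fixes f g :: "'a \<Rightarrow> 'b::euclidean_space"
  assumes e: "e > 0" and h: "\<And>x. h x \<ge> 0" and hM: "\<And>x. h x \<le> M"
    and [measurable]: "f \<in> borel_measurable M'" "g \<in> borel_measurable M'" "h \<in> borel_measurable M'"
  shows "(\<integral>\<^sup>+x. ennreal (h x * (norm (f x))\<^sup>2) \<partial>M') \<le> ennreal (1 + e) * (\<integral>\<^sup>+x. ennreal (h x * (norm (g x))\<^sup>2) \<partial>M')
     + ennreal ((1 + 1/e) * M) * (\<integral>\<^sup>+x. ennreal ((norm (g x - f x))\<^sup>2) \<partial>M')"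
proof -
  have "(\<integral>\<^sup>+x. ennreal (h x * (norm (f x))\<^sup>2) \<partial>M')
     \<le> (\<integral>\<^sup>+x. ennreal (1 + e) * ennreal (h x * (norm (g x))\<^sup>2) + ennreal ((1 + 1/e) * M) * ennreal ((norm (g x - f x))\<^sup>2) \<partial>M')"
  proof (rule nn_integral_mono)
    fix x
    have M0: "M \<ge> 0" using h[of x] hM[of x] by simp
    have "h x * (norm (f x))\<^sup>2 \<le> h x * ((1 + e) * (norm (g x))\<^sup>2 + (1 + 1/e) * (norm (g x - f x))\<^sup>2)"
      using norm_add_sq_le[OF e, of "g x" "f x - g x"] by (intro mult_left_mono h) (simp add: norm_minus_commute)
    also have "\<dots> = (1 + e) * (h x * (norm (g x))\<^sup>2) + h x * ((1 + 1/e) * (norm (g x - f x))\<^sup>2)"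
      by (simp add: algebra_simps)
    also have "h x * ((1 + 1/e) * (norm (g x - f x))\<^sup>2) \<le> M * ((1 + 1/e) * (norm (g x - f x))\<^sup>2)"
      using e by (intro mult_right_mono hM) auto
    finally have "h x * (norm (f x))\<^sup>2 \<le> (1 + e) * (h x * (norm (g x))\<^sup>2) + (1 + 1/e) * M * (norm (g x - f x))\<^sup>2"
      by (simp add: mult.assoc mult.left_commute)
    then show "ennreal (h x * (norm (f x))\<^sup>2) \<le>
        ennreal (1 + e) * ennreal (h x * (norm (g x))\<^sup>2) + ennreal ((1 + 1/e) * M) * ennreal ((norm (g x - f x))\<^sup>2)"
      using e h[of x] M0 by (simp add: ennreal_mult[symmetric] ennreal_plus[symmetric] ennreal_leI del: ennreal_plus)
  qed
  also have "\<dots> = ennreal (1 + e) * (\<integral>\<^sup>+x. ennreal (h x * (norm (g x))\<^sup>2) \<partial>M')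
     + ennreal ((1 + 1/e) * M) * (\<integral>\<^sup>+x. ennreal ((norm (g x - f x))\<^sup>2) \<partial>M')"
    by (simp add: nn_integral_add nn_integral_cmult)
  finally show ?thesis .
qed

text \<open>Riesz-Fischer: a rapidly Cauchy subsequence converges almost everywhere, and Fatou turns
  the Cauchy bound into convergence of the whole sequence to that limit.\<close>

lemma L2_complete:
  fixes F :: "nat \<Rightarrow> 'a::euclidean_space \<Rightarrow> 'b::euclidean_space"
  assumes meas [measurable]: "\<And>n. F n \<in> borel_measurable lebesgue"
    and cauchy: "\<And>e::ennreal. e > 0 \<Longrightarrow> \<exists>M. \<forall>m\<ge>M. \<forall>n\<ge>M. L2_normsq (\<lambda>x. F m x - F n x) < e"
  obtains G where "G \<in> borel_measurable lebesgue" "L2_tendsto F G"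
proof -
  have "\<exists>M. \<forall>m\<ge>M. \<forall>n\<ge>M. L2_normsq (\<lambda>x. F m x - F n x) < ennreal ((1/8)^k)" for k
    by (rule cauchy) (simp add: ennreal_zero_less_one)
  then obtain N where N: "\<And>k m n. m \<ge> N k \<Longrightarrow> n \<ge> N k \<Longrightarrow> L2_normsq (\<lambda>x. F m x - F n x) < ennreal ((1/8)^k)"
    by metis
  \<comment> \<open>The sum of all earlier thresholds makes consecutive members \<open>r k\<close>
    and \<open>r (Suc k)\<close> both exceed \<open>N k\<close>; the summand \<open>k\<close> makes
    \<open>r\<close> unbounded.\<close>
  define r where "r k = k + (\<Sum>i\<le>k. N i)" for k
  have rN: "r k \<ge> N k" for k
    unfolding r_def using member_le_sum[of k "{..k}" N] by simp
  have rS: "r (Suc k) \<ge> N k" for k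
    using rN[of k] by (simp add: r_def)
  have rk: "r k \<ge> k" for k by (simp add: r_def)
  define d where "d k x = (norm (F (r (Suc k)) x - F (r k) x))\<^sup>2" for k x
  have dm [measurable]: "d k \<in> borel_measurable lebesgue" for k
    unfolding d_def by measurable
  \<comment> \<open>Against the bound \<open>(1/8)^k\<close> the weight \<open>4^k\<close> still
    leaves a summable \<open>(1/2)^k\<close>. Pointwise, boundedness of \<open>4^k * d k x\<close>
    makes the increments, whose squares are \<open>d k x\<close>, decay like
    \<open>(1/2)^k\<close>.\<close>
  have "(\<integral>\<^sup>+x. (\<Sum>k. ennreal (4^k * d k x)) \<partial>lebesgue) = (\<Sum>k. \<integral>\<^sup>+x. ennreal (4^k * d k x) \<partial>lebesgue)"
    by (rule nn_integral_suminf) measurable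
  also have "\<dots> \<le> (\<Sum>k. ennreal ((1/2)^k))"
  proof (rule suminf_le)
    fix k
    have "(\<integral>\<^sup>+x. ennreal (4^k * d k x) \<partial>lebesgue) = ennreal (4^k) * L2_normsq (\<lambda>x. F (r (Suc k)) x - F (r k) x)"
      unfolding L2_normsq_def d_def by (simp add: ennreal_mult nn_integral_cmult)
    also have "\<dots> \<le> ennreal (4^k) * ennreal ((1/8)^k)"
      by (intro mult_left_mono less_imp_le[OF N] rN rS) auto
    also have "\<dots> = ennreal ((1/2)^k)"
      by (simp add: ennreal_mult[symmetric] power_mult_distrib[symmetric])
    finally show "(\<integral>\<^sup>+x. ennreal (4^k * d k x) \<partial>lebesgue) \<le> ennreal ((1/2)^k)" .
  qed auto
  also have "\<dots> < \<infinity>"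
    using summable_geometric[of "1/2::real"] by (subst suminf_ennreal2) auto
  finally have "(\<integral>\<^sup>+x. (\<Sum>k. ennreal (4^k * d k x)) \<partial>lebesgue) \<noteq> \<infinity>" by simp
  then have AEf: "AE x in lebesgue. (\<Sum>k. ennreal (4^k * d k x)) \<noteq> \<infinity>"
    by (intro nn_integral_noteq_infinite) auto
  define G where "G x = lim (\<lambda>k. F (r k) x)" for x
  have Gm [measurable]: "G \<in> borel_measurable lebesgue"
    unfolding G_def by (rule borel_measurable_lim_metric) measurable
  have AEl: "AE x in lebesgue. (\<lambda>k. F (r k) x) \<longlonglongrightarrow> G x"
    using AEf
  proof (rule AE_mp, intro AE_I2 impI)
    fix x assume "(\<Sum>k. ennreal (4^k * d k x)) \<noteq> \<infinity>"
    then have "summable (\<lambda>k. 4^k * d k x)"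
      by (intro summable_suminf_not_top) (auto simp: d_def)
    then have "(\<lambda>k. 4^k * d k x) \<longlonglongrightarrow> 0" by (rule summable_LIMSEQ_zero)
    from convergent_imp_Bseq[OF convergentI[OF this]]
    obtain B where B: "\<And>k. norm (4^k * d k x) \<le> B"
      unfolding Bseq_def by auto
    have n: "norm (F (r (Suc k)) x - F (r k) x) \<le> sqrt B * (1/2)^k" for k
    proof -
      have "(2^k * norm (F (r (Suc k)) x - F (r k) x))\<^sup>2 \<le> B"
      proof -
        have "(4::real)^k = (2^k)\<^sup>2" by (simp add: power2_eq_square power_mult_distrib[symmetric])
        then show ?thesis using B[of k] by (simp add: d_def power_mult_distrib)
      qed
      then have "2^k * norm (F (r (Suc k)) x - F (r k) x) \<le> sqrt B"
        by (rule real_le_rsqrt)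
      then show ?thesis by (simp add: field_simps power_divide)
    qed
    have "summable (\<lambda>k. sqrt B * (1/2)^k)"
      by (intro summable_mult summable_geometric) simp
    then have "summable (\<lambda>k. F (r (Suc k)) x - F (r k) x)"
      by (rule summable_comparison_test') (rule n)
    then have "convergent (\<lambda>n. \<Sum>k<n. F (r (Suc k)) x - F (r k) x)"
      by (simp add: summable_iff_convergent)
    then have "convergent (\<lambda>n. F (r n) x - F (r 0) x)"
      by (simp only: sum_lessThan_telescope[of "\<lambda>k. F (r k) x"])
    then have "convergent (\<lambda>n. F (r n) x)"
      using convergent_diff_const_right_iff by blast
    then show "(\<lambda>k. F (r k) x) \<longlonglongrightarrow> G x"
      unfolding G_def by (simp add: convergent_LIMSEQ_iff)
  qed
  have fatou: "L2_normsq (\<lambda>x. F m x - G x) \<le> e" if M: "\<And>n. n \<ge> M \<Longrightarrow> L2_normsq (\<lambda>x. F m x - F n x) \<le> e" for m M e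
  proof -
    have "L2_normsq (\<lambda>x. F m x - G x) = (\<integral>\<^sup>+x. liminf (\<lambda>k. ennreal ((norm (F m x - F (r k) x))\<^sup>2)) \<partial>lebesgue)"
      unfolding L2_normsq_def
    proof (rule nn_integral_cong_AE)
      show "AE x in lebesgue. ennreal ((norm (F m x - G x))\<^sup>2) = liminf (\<lambda>k. ennreal ((norm (F m x - F (r k) x))\<^sup>2))"
        using AEl
      proof (rule AE_mp, intro AE_I2 impI)
        fix x assume "(\<lambda>k. F (r k) x) \<longlonglongrightarrow> G x"
        then have "(\<lambda>k. ennreal ((norm (F m x - F (r k) x))\<^sup>2)) \<longlonglongrightarrow> ennreal ((norm (F m x - G x))\<^sup>2)"
          by (intro tendsto_intros)
        then show "ennreal ((norm (F m x - G x))\<^sup>2) = liminf (\<lambda>k. ennreal ((norm (F m x - F (r k) x))\<^sup>2))"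
          by (intro lim_imp_Liminf[symmetric]) simp_all
      qed
    qed
    also have "\<dots> \<le> liminf (\<lambda>k. \<integral>\<^sup>+x. ennreal ((norm (F m x - F (r k) x))\<^sup>2) \<partial>lebesgue)"
      by (rule nn_integral_liminf) measurable
    also have "\<dots> \<le> e"
    proof (rule Liminf_le)
      show "\<forall>\<^sub>F k in sequentially. (\<integral>\<^sup>+x. ennreal ((norm (F m x - F (r k) x))\<^sup>2) \<partial>lebesgue) \<le> e"
        using eventually_ge_at_top[of M]
      proof eventually_elim
        case (elim k)
        then show ?case using M[of "r k"] rk[of k] by (simp add: L2_normsq_def)
      qed
    qed simp
    finally show ?thesis .
  qed
  have "L2_tendsto F G"
    unfolding L2_tendsto_def
  proof (rule tendsto_zero_ennreal)
    fix e :: real assume e: "e > 0"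
    then obtain M where M: "\<And>m n. m \<ge> M \<Longrightarrow> n \<ge> M \<Longrightarrow> L2_normsq (\<lambda>x. F m x - F n x) < ennreal (e / 2)"
      using cauchy[of "ennreal (e / 2)"] by auto
    show "\<forall>\<^sub>F m in sequentially. L2_normsq (\<lambda>x. F m x - G x) < ennreal e"
      using eventually_ge_at_top[of M]
    proof eventually_elim
      case (elim m)
      have "L2_normsq (\<lambda>x. F m x - G x) \<le> ennreal (e / 2)"
        by (rule fatou[of M]) (use M[OF elim] in \<open>auto intro: less_imp_le\<close>)
      also have "\<dots> < ennreal e" using e by (simp add: ennreal_lessI)
      finally show ?case .
    qed
  qed
  with Gm show ?thesis by (rule that)
qed

subsection \<open>Passage to the form domain\<close>

lemma cov_deriv_test_diff:
  assumes "smooth f" "smooth g"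
  shows "cov_deriv_test \<alpha> j (\<lambda>x. f x - g x) x = cov_deriv_test \<alpha> j f x - cov_deriv_test \<alpha> j g x"
proof -
  have "frechet_derivative (\<lambda>x. f x - g x) (at x) = (\<lambda>v. frechet_derivative f (at x) v - frechet_derivative g (at x) v)"
    using has_derivative_diff[OF smooth_has_derivative[OF assms(1)] smooth_has_derivative[OF assms(2)]]
    by (rule frechet_derivative_at[symmetric])
  then show ?thesis
    by (simp add: cov_deriv_test_def vec_eq_iff algebra_simps)
qed

lemma continuous_on_cov_deriv_test:
  fixes \<phi> :: "'n::finite config \<Rightarrow> complex"
  assumes sm: "smooth \<phi>" and K: "K \<inter> coincidence = {}"
  shows "continuous_on K (cov_deriv_test \<alpha> j \<phi>)"
proof -
  have ne: "x $ j - x $ k \<noteq> 0" if "x \<in> K" "k \<in> -{j}" for x k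
    using that K unfolding coincidence_def by fastforce
  have c: "continuous_on K \<phi>" "continuous_on K (\<lambda>x. frechet_derivative \<phi> (at x) v)" for v
    using smooth_continuous[OF sm] smooth_continuous_derivative[OF sm] by (auto intro: continuous_on_subset)
  show ?thesis
    unfolding cov_deriv_test_def[abs_def] vinv_def
    by (intro continuous_on_vec_lambda continuous_intros continuous_on_rot c) (use ne in auto)
qed

text \<open>The support is compact and avoids the coincidences, so the expression is continuous,
  hence bounded, on it and vanishes elsewhere. This lets a limit of such functions be recognised as
  an element of \<open>L2\<close>.\<close>

lemma L2_normsq_cov_deriv_test_finite:
  fixes \<phi> :: "'n::finite config \<Rightarrow> complex"
  assumes \<phi>: "\<phi> \<in> sym_test_functions"
  shows "L2_normsq (cov_deriv_test \<alpha> j \<phi>) < \<infinity>"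
proof -
  define K where "K = closure {x. \<phi> x \<noteq> 0}"
  have sm: "smooth \<phi>" and K: "compact K" "K \<inter> coincidence = {}"
    using \<phi> by (auto simp: sym_test_functions_def K_def)
  have "compact (cov_deriv_test \<alpha> j \<phi> ` K)"
    using continuous_on_cov_deriv_test[OF sm K(2)] K(1) by (rule compact_continuous_image)
  then obtain B where B: "\<And>x. x \<in> K \<Longrightarrow> norm (cov_deriv_test \<alpha> j \<phi> x) \<le> B"
    using compact_imp_bounded bounded_iff by (metis imageI)
  have z: "cov_deriv_test \<alpha> j \<phi> x = 0" if "x \<notin> K" for x
  proof -
    have 0: "\<phi> y = 0" if "y \<notin> K" for y
      using that closure_subset[of "{x. \<phi> x \<noteq> 0}"] by (auto simp: K_def)
    have "(\<phi> has_derivative (\<lambda>v. 0)) (at x)"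
      by (rule has_derivative_transform_within_open[where f="\<lambda>_. 0" and s="- K"])
        (use that K(1) 0 in \<open>auto intro: compact_imp_closed\<close>)
    then have "frechet_derivative \<phi> (at x) = (\<lambda>v. 0)"
      by (rule frechet_derivative_at[symmetric])
    then show ?thesis using 0[OF that] by (simp add: cov_deriv_test_def vec_eq_iff)
  qed
  have "L2_normsq (cov_deriv_test \<alpha> j \<phi>) \<le> (\<integral>\<^sup>+x. ennreal (B\<^sup>2) * indicator K x \<partial>lebesgue)"
    unfolding L2_normsq_def
  proof (rule nn_integral_mono)
    fix x
    show "ennreal ((norm (cov_deriv_test \<alpha> j \<phi> x))\<^sup>2) \<le> ennreal (B\<^sup>2) * indicator K x"
      using B[of x] z[of x] by (cases "x \<in> K") (auto intro!: ennreal_leI power_mono)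
  qed
  also have "\<dots> = ennreal (B\<^sup>2) * emeasure lborel K"
    using K(1) by (simp add: nn_integral_completion nn_integral_cmult_indicator compact_imp_closed borel_closed)
  also have "\<dots> < \<infinity>"
    using emeasure_compact_finite[OF K(1)] by (simp add: ennreal_mult_less_top)
  finally show ?thesis .
qed

text \<open>Completeness supplies a witness for the choice in \<open>cov_deriv\<close>. The sequence
  obtained is the one attached to the chosen limits, which may differ from the sequence given by the
  domain.\<close>

lemma cov_deriv_limit:
  fixes u :: "'n::finite config \<Rightarrow> complex"
  assumes "u \<in> anyon_domain \<alpha>"
  obtains \<phi> where "form_approx \<alpha> \<phi> u"
    "\<And>j. cov_deriv \<alpha> u j \<in> L2"
    "\<And>j. L2_tendsto (\<lambda>n. cov_deriv_test \<alpha> j (\<phi> n)) (cov_deriv \<alpha> u j)"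
proof -
  obtain \<phi> where \<phi>: "form_approx \<alpha> \<phi> u"
    using assms by (auto simp: anyon_domain_def)
  then have test: "\<phi> n \<in> sym_test_functions" for n by (simp add: form_approx_def)
  then have sm: "smooth (\<phi> n)" for n by (simp add: sym_test_functions_def)
  have "\<exists>G. G \<in> L2 \<and> L2_tendsto (\<lambda>n. cov_deriv_test \<alpha> j (\<phi> n)) G" for j
  proof -
    have meas: "cov_deriv_test \<alpha> j (\<phi> n) \<in> borel_measurable lebesgue" for n
      using borel_measurable_cov_deriv_test[OF sm] by (intro measurable_completion) simp
    have le: "L2_normsq (\<lambda>x. cov_deriv_test \<alpha> j (\<phi> m) x - cov_deriv_test \<alpha> j (\<phi> n) x) \<le> qform \<alpha> (\<lambda>x. \<phi> m x - \<phi> n x)" for m n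
    proof -
      have "L2_normsq (\<lambda>x. cov_deriv_test \<alpha> j (\<phi> m) x - cov_deriv_test \<alpha> j (\<phi> n) x)
          = L2_normsq (cov_deriv_test \<alpha> j (\<lambda>x. \<phi> m x - \<phi> n x))"
        unfolding cov_deriv_test_diff[OF sm sm, abs_def] ..
      also have "\<dots> \<le> qform \<alpha> (\<lambda>x. \<phi> m x - \<phi> n x)"
        unfolding qform_def by (rule member_le_sum) auto
      finally show ?thesis .
    qed
    have "\<exists>M. \<forall>m\<ge>M. \<forall>n\<ge>M. L2_normsq (\<lambda>x. cov_deriv_test \<alpha> j (\<phi> m) x - cov_deriv_test \<alpha> j (\<phi> n) x) < e" if e: "e > 0" for e
    proof -
      obtain M where "\<forall>m\<ge>M. \<forall>n\<ge>M. qform \<alpha> (\<lambda>x. \<phi> m x - \<phi> n x) < e"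
        using \<phi> e unfolding form_approx_def by blast
      then show ?thesis using le_less_trans[OF le] by blast
    qed
    from L2_complete[OF meas this] obtain G where G: "G \<in> borel_measurable lebesgue"
        "L2_tendsto (\<lambda>n. cov_deriv_test \<alpha> j (\<phi> n)) G" by blast
    have "\<forall>\<^sub>F n in sequentially. L2_normsq (\<lambda>x. cov_deriv_test \<alpha> j (\<phi> n) x - G x) < 1"
      using G(2) unfolding L2_tendsto_def by (rule order_tendstoD) simp
    then obtain n where n: "L2_normsq (\<lambda>x. cov_deriv_test \<alpha> j (\<phi> n) x - G x) < 1"
      by (auto simp: eventually_sequentially)
    have "L2_normsq G \<le> ennreal (1 + 1) * L2_normsq (cov_deriv_test \<alpha> j (\<phi> n))
        + ennreal ((1 + 1/1) * 1) * L2_normsq (\<lambda>x. cov_deriv_test \<alpha> j (\<phi> n) x - G x)"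
      using nn_integral_weighted_sq_le[of 1 "\<lambda>_. 1" 1 G lebesgue "cov_deriv_test \<alpha> j (\<phi> n)"] G(1) meas
      unfolding L2_normsq_def by simp
    also have "\<dots> < \<infinity>"
      using L2_normsq_cov_deriv_test_finite[OF test, of \<alpha> j n] n less_trans[OF n, of \<infinity>]
      by (simp add: ennreal_mult_less_top)
    finally have "G \<in> L2" using G(1) by (simp add: L2_def)
    then show ?thesis using G(2) by blast
  qed
  then obtain G where G: "\<And>j. G j \<in> L2 \<and> L2_tendsto (\<lambda>n. cov_deriv_test \<alpha> j (\<phi> n)) (G j)" by metis
  have "\<exists>G \<phi>. form_approx \<alpha> \<phi> u \<and> (\<forall>j. G j \<in> L2 \<and> L2_tendsto (\<lambda>n. cov_deriv_test \<alpha> j (\<phi> n)) (G j))"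
    using \<phi> G by blast
  from someI_ex[OF this] show ?thesis
    unfolding cov_deriv_def[symmetric] using that by blast
qed

text \<open>The indicator of the configurations in \<open>\<Omega>\<close> merges with those of
  \<open>circ_self\<close> into indicators of the open sets \<open>pair_region\<close>.\<close>

lemma borel_measurable_hardy_weight:
  assumes "open \<Omega>"
  shows "(\<lambda>x::'n::{finite,linorder} config. indicator (config_in \<Omega>) x * hardy_weight \<Omega> x) \<in> borel_measurable borel"
proof -
  have [measurable]: "pair_region \<Omega> i j \<in> sets (borel :: 'n config measure)" for i j
    using open_pair_region[OF assms] by (rule borel_open)
  have [measurable]: "(\<lambda>x::'n config. x $ m) \<in> borel_measurable borel" for m
    by (intro borel_measurable_continuous_onI continuous_intros)
  have eq: "indicator (config_in \<Omega>) x * hardy_weight \<Omega> x =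
     (\<Sum>p\<in>{(i, j). i < j}. indicator (pair_region \<Omega> (fst p) (snd p)) x / (norm (x $ fst p - x $ snd p))\<^sup>2)" for x :: "'n config"
    unfolding hardy_weight_def sum_distrib_left case_prod_unfold
    by (rule sum.cong) (auto simp: pair_region_def indicator_def)
  show ?thesis unfolding eq by measurable
qed

text \<open>One factor \<open>1 + e\<close> pays for replacing \<open>u\<close> by a test function
  under the truncated weight, the other for replacing the derivatives of that test function by their
  limits.\<close>

lemma hardy_truncated:
  fixes u :: "'n::{finite,linorder} config \<Rightarrow> complex"
  assumes u: "u \<in> anyon_domain \<alpha>" and \<Omega>: "open \<Omega>" and e: "e > 0" and M: "M \<ge> 0"
  defines "K \<equiv> ennreal (4 * (anyon_const \<alpha> CARD('n))\<^sup>2 / real CARD('n))"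
    and "W \<equiv> \<lambda>x. indicator (config_in \<Omega>) x * hardy_weight \<Omega> x"
  shows "K * (\<integral>\<^sup>+x. ennreal (min (W x) M * (norm (u x))\<^sup>2) \<partial>lebesgue)
    \<le> ennreal ((1 + e)\<^sup>2) * (\<integral>\<^sup>+x\<in>config_in \<Omega>. ennreal (\<Sum>j\<in>UNIV. (norm (cov_deriv \<alpha> u j x))\<^sup>2) \<partial>lebesgue)"
proof -
  obtain \<phi> where \<phi>: "form_approx \<alpha> \<phi> u" and GL2: "\<And>j. cov_deriv \<alpha> u j \<in> L2"
    and lim: "\<And>j. L2_tendsto (\<lambda>n. cov_deriv_test \<alpha> j (\<phi> n)) (cov_deriv \<alpha> u j)"
    using cov_deriv_limit[OF u] by metis
  have test: "\<phi> n \<in> sym_test_functions" for n using \<phi> by (simp add: form_approx_def)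
  then have sm: "smooth (\<phi> n)" for n by (simp add: sym_test_functions_def)
  define G where "G = cov_deriv \<alpha> u"
  define D where "D n j = cov_deriv_test \<alpha> j (\<phi> n)" for n j
  have Dm [measurable]: "D n j \<in> borel_measurable lebesgue" for n j
    using borel_measurable_cov_deriv_test[OF sm] unfolding D_def by (intro measurable_completion) simp
  have [measurable]: "\<phi> n \<in> borel_measurable lebesgue" for n
    by (intro measurable_completion) (simp add: borel_measurable_continuous_onI smooth_continuous sm)
  have [measurable]: "G j \<in> borel_measurable lebesgue" for j
    using GL2 by (simp add: G_def L2_def)
  have [measurable]: "u \<in> borel_measurable lebesgue"
    using u by (simp add: anyon_domain_def L2_sym_def L2_def)
  have [measurable]: "config_in \<Omega> \<in> sets (lebesgue :: 'n config measure)"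
    by (intro sets_completionI_sets) (simp add: borel_open open_config_in \<Omega>)
  have [measurable]: "W \<in> borel_measurable lebesgue"
    using borel_measurable_hardy_weight[OF \<Omega>] unfolding W_def by (intro measurable_completion) simp
  have W0: "0 \<le> W x" for x by (simp add: W_def hardy_weight_nonneg)
  let ?I = "\<lambda>f. \<integral>\<^sup>+x. f x \<partial>(lebesgue :: 'n config measure)"
  let ?ind = "indicator (config_in \<Omega>) :: 'n config \<Rightarrow> real"
  define L where "L = (\<integral>\<^sup>+x\<in>config_in \<Omega>. ennreal (\<Sum>j\<in>UNIV. (norm (G j x))\<^sup>2) \<partial>lebesgue)"
  have split: "(\<integral>\<^sup>+x\<in>config_in \<Omega>. ennreal (\<Sum>j\<in>UNIV. (norm (H j x))\<^sup>2) \<partial>lebesgue)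
     = (\<Sum>j\<in>UNIV. ?I (\<lambda>x. ennreal (?ind x * (norm (H j x))\<^sup>2)))"
    if [measurable]: "\<And>j. H j \<in> borel_measurable lebesgue" for H :: "'n \<Rightarrow> 'n config \<Rightarrow> complex^2"
  proof -
    have "(\<integral>\<^sup>+x\<in>config_in \<Omega>. ennreal (\<Sum>j\<in>UNIV. (norm (H j x))\<^sup>2) \<partial>lebesgue)
      = ?I (\<lambda>x. \<Sum>j\<in>UNIV. ennreal (?ind x * (norm (H j x))\<^sup>2))"
      by (intro nn_integral_cong) (auto simp: indicator_def sum_ennreal)
    also have "\<dots> = (\<Sum>j\<in>UNIV. ?I (\<lambda>x. ennreal (?ind x * (norm (H j x))\<^sup>2)))"
      by (rule nn_integral_sum) measurable
    finally show ?thesis .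
  qed
  define \<delta> where "\<delta> n = (\<Sum>j\<in>UNIV. L2_normsq (\<lambda>x. D n j x - G j x))" for n
  define \<epsilon> where "\<epsilon> n = L2_normsq (\<lambda>x. \<phi> n x - u x)" for n
  have \<delta>0: "\<delta> \<longlonglongrightarrow> 0"
  proof -
    have "(\<lambda>n. \<Sum>j\<in>UNIV. L2_normsq (\<lambda>x. D n j x - G j x)) \<longlonglongrightarrow> (\<Sum>j\<in>(UNIV :: 'n set). 0)"
      using lim by (intro tendsto_sum) (simp add: L2_tendsto_def D_def G_def)
    then show ?thesis by (simp add: \<delta>_def[abs_def])
  qed
  have \<epsilon>0: "\<epsilon> \<longlonglongrightarrow> 0"
    using \<phi> by (simp add: form_approx_def L2_tendsto_def \<epsilon>_def[abs_def])
  have bound: "K * ?I (\<lambda>x. ennreal (min (W x) M * (norm (u x))\<^sup>2))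
     \<le> ennreal ((1 + e)\<^sup>2) * L + (ennreal ((1 + e) * (1 + 1/e)) * \<delta> n + K * ennreal ((1 + 1/e) * M) * \<epsilon> n)" for n
  proof -
    have 1: "?I (\<lambda>x. ennreal (min (W x) M * (norm (u x))\<^sup>2))
      \<le> ennreal (1 + e) * ?I (\<lambda>x. ennreal (W x * (norm (\<phi> n x))\<^sup>2)) + ennreal ((1 + 1/e) * M) * \<epsilon> n"
    proof -
      have "?I (\<lambda>x. ennreal (min (W x) M * (norm (u x))\<^sup>2))
        \<le> ennreal (1 + e) * ?I (\<lambda>x. ennreal (min (W x) M * (norm (\<phi> n x))\<^sup>2)) + ennreal ((1 + 1/e) * M) * \<epsilon> n"
        unfolding \<epsilon>_def L2_normsq_def by (rule nn_integral_weighted_sq_le[OF e]) (use W0 M in auto)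
      also have "\<dots> \<le> ennreal (1 + e) * ?I (\<lambda>x. ennreal (W x * (norm (\<phi> n x))\<^sup>2)) + ennreal ((1 + 1/e) * M) * \<epsilon> n"
        by (intro add_right_mono mult_left_mono nn_integral_mono ennreal_leI mult_right_mono) auto
      finally show ?thesis .
    qed
    have 2: "K * ?I (\<lambda>x. ennreal (W x * (norm (\<phi> n x))\<^sup>2)) \<le> (\<Sum>j\<in>UNIV. ?I (\<lambda>x. ennreal (?ind x * (norm (D n j x))\<^sup>2)))"
    proof -
      have "?I (\<lambda>x. ennreal (W x * (norm (\<phi> n x))\<^sup>2))
         = (\<integral>\<^sup>+x\<in>config_in \<Omega>. ennreal (hardy_weight \<Omega> x * (norm (\<phi> n x))\<^sup>2) \<partial>lborel)"
        unfolding nn_integral_completion by (intro nn_integral_cong) (auto simp: W_def indicator_def)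
      then show ?thesis
        using hardy_test_function[OF test \<Omega>, of \<alpha> n] split[OF Dm]
        unfolding K_def D_def nn_integral_completion by simp
    qed
    have 3: "?I (\<lambda>x. ennreal (?ind x * (norm (D n j x))\<^sup>2)) \<le> ennreal (1 + e) * ?I (\<lambda>x. ennreal (?ind x * (norm (G j x))\<^sup>2))
       + ennreal (1 + 1/e) * L2_normsq (\<lambda>x. D n j x - G j x)" for j
      using nn_integral_weighted_sq_le[OF e, of ?ind 1 "D n j" lebesgue "G j"]
      by (simp add: L2_normsq_def norm_minus_commute[of "G j _"] indicator_le_1)
    have "(\<Sum>j\<in>UNIV. ?I (\<lambda>x. ennreal (?ind x * (norm (D n j x))\<^sup>2))) \<le>
       (\<Sum>j\<in>UNIV. ennreal (1 + e) * ?I (\<lambda>x. ennreal (?ind x * (norm (G j x))\<^sup>2)) + ennreal (1 + 1/e) * L2_normsq (\<lambda>x. D n j x - G j x))"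
      by (rule sum_mono) (rule 3)
    also have "\<dots> = ennreal (1 + e) * L + ennreal (1 + 1/e) * \<delta> n"
      unfolding L_def split[OF \<open>\<And>j. G j \<in> borel_measurable lebesgue\<close>] \<delta>_def by (simp only: sum.distrib sum_distrib_left)
    finally have 4: "(\<Sum>j\<in>UNIV. ?I (\<lambda>x. ennreal (?ind x * (norm (D n j x))\<^sup>2))) \<le> ennreal (1 + e) * L + ennreal (1 + 1/e) * \<delta> n" .
    have "K * ?I (\<lambda>x. ennreal (min (W x) M * (norm (u x))\<^sup>2))
      \<le> K * (ennreal (1 + e) * ?I (\<lambda>x. ennreal (W x * (norm (\<phi> n x))\<^sup>2)) + ennreal ((1 + 1/e) * M) * \<epsilon> n)"
      by (intro mult_left_mono 1) simp
    also have "\<dots> = ennreal (1 + e) * (K * ?I (\<lambda>x. ennreal (W x * (norm (\<phi> n x))\<^sup>2))) + K * ennreal ((1 + 1/e) * M) * \<epsilon> n"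
      by (simp only: distrib_left ac_simps)
    also have "\<dots> \<le> ennreal (1 + e) * (ennreal (1 + e) * L + ennreal (1 + 1/e) * \<delta> n) + K * ennreal ((1 + 1/e) * M) * \<epsilon> n"
      by (intro add_right_mono mult_left_mono order_trans[OF 2 4]) simp
    also have "\<dots> = ennreal ((1 + e)\<^sup>2) * L + (ennreal ((1 + e) * (1 + 1/e)) * \<delta> n + K * ennreal ((1 + 1/e) * M) * \<epsilon> n)"
      using e by (simp only: distrib_left mult.assoc[symmetric] add.assoc power2_eq_square ennreal_mult'[symmetric])
    finally show ?thesis .
  qed
  \<comment> \<open>With \<open>e\<close> and \<open>M\<close> fixed, the coefficients of
    \<open>\<delta> n\<close> and \<open>\<epsilon> n\<close> are finite, so both errors vanish in
    the limit.\<close>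
  have "(\<lambda>n. ennreal ((1 + e)\<^sup>2) * L + (ennreal ((1 + e) * (1 + 1/e)) * \<delta> n + K * ennreal ((1 + 1/e) * M) * \<epsilon> n))
    \<longlonglongrightarrow> ennreal ((1 + e)\<^sup>2) * L + (ennreal ((1 + e) * (1 + 1/e)) * 0 + K * ennreal ((1 + 1/e) * M) * 0)"
    by (intro tendsto_add tendsto_const ennreal_tendsto_cmult \<delta>0 \<epsilon>0) (auto simp: K_def ennreal_mult_less_top)
  then have "K * ?I (\<lambda>x. ennreal (min (W x) M * (norm (u x))\<^sup>2))
     \<le> ennreal ((1 + e)\<^sup>2) * L + (ennreal ((1 + e) * (1 + 1/e)) * 0 + K * ennreal ((1 + 1/e) * M) * 0)"
    by (rule LIMSEQ_le_const) (use bound in blast)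
  then show ?thesis by (simp add: L_def G_def)
qed

theorem theorem4:
  fixes \<alpha> :: real
    and \<Omega> :: "(real^2) set"
    and u :: "('n::{finite,linorder}) config \<Rightarrow> complex"
  assumes "CARD('n) \<ge> 2"
    and "open \<Omega>" and "convex \<Omega>"
    and "u \<in> anyon_domain \<alpha>"
  shows "(\<integral>\<^sup>+x\<in>config_in \<Omega>. ennreal (\<Sum>j\<in>UNIV. (norm (cov_deriv \<alpha> u j x))\<^sup>2) \<partial>lebesgue)
    \<ge> ennreal (4 * (anyon_const \<alpha> CARD('n))\<^sup>2 / real CARD('n)) *
      (\<integral>\<^sup>+x\<in>config_in \<Omega>. ennreal (\<Sum>(i, j)\<in>{(i, j). i < j}.
          (norm (u x))\<^sup>2 / (norm (x $ i - x $ j))\<^sup>2 * indicator (circ_self \<Omega>) (x $ i, x $ j))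
        \<partial>lebesgue)"
proof -
  define K where "K = ennreal (4 * (anyon_const \<alpha> CARD('n))\<^sup>2 / real CARD('n))"
  define L where "L = (\<integral>\<^sup>+x\<in>config_in \<Omega>. ennreal (\<Sum>j\<in>UNIV. (norm (cov_deriv \<alpha> u j x))\<^sup>2) \<partial>lebesgue)"
  define W :: "'n config \<Rightarrow> real" where "W x = indicator (config_in \<Omega>) x * hardy_weight \<Omega> x" for x
  define g where "g M x = ennreal (min (W x) (real M) * (norm (u x))\<^sup>2)" for M :: nat and x
  have [measurable]: "u \<in> borel_measurable lebesgue"
    using assms(4) by (simp add: anyon_domain_def L2_sym_def L2_def)
  have [measurable]: "W \<in> borel_measurable lebesgue"
    using borel_measurable_hardy_weight[OF assms(2)] unfolding W_def by (intro measurable_completion) simp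
  have trunc: "K * (\<integral>\<^sup>+x. g M x \<partial>lebesgue) \<le> L" for M
  \<comment> \<open>For finite \<open>L\<close> the constant \<open>(1 + e)^2\<close> can be sent to
    1 along \<open>e = 1/(n+1)\<close>, multiplication by \<open>L\<close> being continuous.\<close>
  proof (cases "L = \<infinity>")
    case False
    have "(\<lambda>n. ennreal ((1 + inverse (real (Suc n)))\<^sup>2)) \<longlonglongrightarrow> ennreal ((1 + 0)\<^sup>2)"
      by (intro tendsto_intros LIMSEQ_inverse_real_of_nat)
    from ennreal_tendsto_cmult[OF _ this, of L] False
    have "(\<lambda>n. ennreal ((1 + inverse (real (Suc n)))\<^sup>2) * L) \<longlonglongrightarrow> L"
      by (simp add: mult.commute less_top)
    then show ?thesis
    proof (rule LIMSEQ_le_const)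
      have "K * (\<integral>\<^sup>+x. g M x \<partial>lebesgue) \<le> ennreal ((1 + inverse (real (Suc n)))\<^sup>2) * L" for n
        unfolding K_def L_def g_def W_def by (rule hardy_truncated[OF assms(4,2)]) auto
      then show "\<exists>N. \<forall>n\<ge>N. K * (\<integral>\<^sup>+x. g M x \<partial>lebesgue) \<le> ennreal ((1 + inverse (real (Suc n)))\<^sup>2) * L" by blast
    qed
  qed simp
  have inc: "incseq g"
    unfolding incseq_def le_fun_def g_def by (auto intro!: ennreal_leI mult_right_mono min.mono)
  have sup: "(SUP M. g M x) = ennreal (W x * (norm (u x))\<^sup>2)" for x
  proof (rule antisym)
    show "(SUP M. g M x) \<le> ennreal (W x * (norm (u x))\<^sup>2)"
      unfolding g_def by (intro SUP_least ennreal_leI mult_right_mono) auto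
    \<comment> \<open>\<open>W x\<close> is a real number, so the truncation at a large enough
      \<open>M\<close> already equals it.\<close>
    obtain M where "W x \<le> real M" using real_arch_simple by blast
    then have "ennreal (W x * (norm (u x))\<^sup>2) = g M x" by (simp add: g_def)
    then show "ennreal (W x * (norm (u x))\<^sup>2) \<le> (SUP M. g M x)" by (auto intro: SUP_upper)
  qed
  have "(\<integral>\<^sup>+x\<in>config_in \<Omega>. ennreal (\<Sum>(i, j)\<in>{(i, j). i < j}.
          (norm (u x))\<^sup>2 / (norm (x $ i - x $ j))\<^sup>2 * indicator (circ_self \<Omega>) (x $ i, x $ j)) \<partial>lebesgue)
     = (\<integral>\<^sup>+x. ennreal (W x * (norm (u x))\<^sup>2) \<partial>lebesgue)"
    unfolding W_def hardy_weight_def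
    by (intro nn_integral_cong) (auto simp: indicator_def sum_distrib_right case_prod_unfold intro!: arg_cong[of _ _ ennreal] sum.cong)
  also have "\<dots> = (SUP M. \<integral>\<^sup>+x. g M x \<partial>lebesgue)"
    unfolding sup[symmetric] by (rule nn_integral_monotone_convergence_SUP[OF inc]) (unfold g_def, measurable)
  finally have "K * (\<integral>\<^sup>+x\<in>config_in \<Omega>. ennreal (\<Sum>(i, j)\<in>{(i, j). i < j}.
          (norm (u x))\<^sup>2 / (norm (x $ i - x $ j))\<^sup>2 * indicator (circ_self \<Omega>) (x $ i, x $ j)) \<partial>lebesgue)
     = (SUP M. K * (\<integral>\<^sup>+x. g M x \<partial>lebesgue))"
    by (simp add: SUP_mult_left_ennreal)
  also have "\<dots> \<le> L" by (intro SUP_least trunc)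
  finally show ?thesis by (simp add: K_def L_def)
qed

end
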